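(* Let $\bullet\in\{\triangledown,\dot{\triangledown}\}$ and let $\Gamma\cup\{\psi\}$ be a set of $\mathcal{ML}(\bullet)$-formulas. If $\Gamma\models\psi$, then $\Gamma\vdash\psi$, where $\vdash$ is derivability in the natural deduction system for $\mathcal{ML}(\bullet)$.
   Context: SYNTAX. Fix a countably infinite set $\mathsf{Prop}$ of propositional symbols. Classical formulas ($\mathcal{ML}$): $\alpha::=p\mid\bot\mid\neg\alpha\mid(\alpha\lor\alpha)\mid(\alpha\land\alpha)\mid\Diamond\alpha\mid\Box\alpha$; the letter $\alpha$ always denotes a classical formula. For $\bullet\in\{\triangledown,\dot{\triangledown}\}$ ($\triangledown$ is the might operator, $\dot{\triangledown}$ the singular might operator), $\mathcal{ML}(\bullet)$: $\phi::=p\mid\bot\mid\neg\alpha\mid(\phi\lor\phi)\mid(\phi\land\phi)\mid\Diamond\phi\mid\Box\phi\mid\bullet\phi$. SEMANTICS. A Kripke model is $M=(W,R,V)$ with $R\subseteq W\times W$ and $V$ assigning a subset of $W$ to each relevant propositional symbol; a team is a set $T\subseteq W$. $R[T]=\{v\mid\exists w\in T:wRv\}$, $R^{-1}[T]=\{w\mid\exists v\in T:wRv\}$; $TRS$ means $S\subseteq R[T]$ and $T\subseteq R^{-1}[S]$. $M,T\models p$ iff $T\subseteq V(p)$; $\models\bot$ iff $T=\emptyset$; $M,T\models\neg\alpha$ iff $M,\{w\}\not\models\alpha$ for all $w\in T$; $M,T\models\phi\lor\psi$ iff $T=T_1\cup T_2$ for some $T_1,T_2$ with $M,T_1\models\phi$,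 $M,T_2\models\psi$; $M,T\models\phi\land\psi$ iff both hold at $M,T$; $M,T\models\Diamond\phi$ iff $M,S\models\phi$ for some $S$ with $TRS$; $M,T\models\Box\phi$ iff $M,R[T]\models\phi$; $M,T\models\triangledown\phi$ iff $T=\emptyset$ or there is a nonempty $S\subseteq T$ with $M,S\models\phi$; $M,T\models\dot{\triangledown}\phi$ iff $T=\emptyset$ or there is $w\in T$ with $M,\{w\}\models\phi$. $\Gamma\models\phi$ means: for all models $M$ and teams $T$ of $M$, if $M,T\models\gamma$ for all $\gamma\in\Gamma$ then $M,T\models\phi$. PROOF SYSTEM for $\mathcal{ML}(\bullet)$. $\Gamma\vdash\phi$ means that $\phi$ has a natural deduction derivation whose undischarged assumptions all lie in $\Gamma$. Equivalently, $\vdash$ is the least relation such that $\Gamma\vdash\phi$ whenever $\phi\in\Gamma$, and closed under the following rules. "$\phi_1,\dots,\phi_n\,/\,\psi$" means: if $\Gamma\vdash\phi_i$ for all $i$, then $\Gamma\vdash\psi$. $\Delta$ always denotes a set of classical formulas with $\Delta\subseteq\Gamma$. Classical rules: ($\neg$I) if $\Delta\cup\{\alpha\}\vdash\bot$ then $\Gamma\vdash\neg\alpha$. (RAA) if $\Delta\cup\{\neg\alpha\}\vdash\bot$ then $\Gamma\vdash\alpha$. ($\neg$E) $\alpha,\neg\alpha\,/\,\phi$. ($\lor$I) $\phi\,/\,\phi\lor\psi$ and $\psi\,/\,\phi\lor\psi$. ($\lor$E) if $\Gamma\vdash\phi\lor\psi$, $\Delta\cup\{\phi\}\vdash\chi$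 and $\Delta\cup\{\psi\}\vdash\chi$ then $\Gamma\vdash\chi$. ($\land$I) $\phi,\psi\,/\,\phi\land\psi$. ($\land$E) $\phi\land\psi\,/\,\phi$ and $\phi\land\psi\,/\,\psi$. ($\Diamond\Box$Inter) $\neg\Box\alpha\,/\,\Diamond\neg\alpha$. ($\Box\Diamond$Inter) $\Diamond\neg\alpha\,/\,\neg\Box\alpha$. ($\Diamond\lor$Distr) $\Diamond(\phi\lor\psi)\,/\,\Diamond\phi\lor\Diamond\psi$. ($\Box$Mon) if $\{\phi_1,\dots,\phi_n\}\vdash\psi$ and $\Gamma\vdash\Box\phi_i$ for $i=1,\dots,n$ then $\Gamma\vdash\Box\psi$ ($n\ge 0$). ($\Diamond$Mon) if $\{\phi\}\vdash\psi$ and $\Gamma\vdash\Diamond\phi$ then $\Gamma\vdash\Diamond\psi$. Rules only for $\bullet=\triangledown$: ($\triangledown$Join) $\triangledown\phi,\triangledown\psi\,/\,\triangledown((\phi\lor\psi)\land\triangledown\phi\land\triangledown\psi)$. ($\triangledown$E) $\triangledown\triangledown\phi\,/\,\triangledown\phi$. Rule only for $\bullet=\dot{\triangledown}$: ($\dot{\triangledown}\land$Simpl) $\dot{\triangledown}(\dot{\triangledown}\phi\land\psi)\,/\,\dot{\triangledown}(\phi\land\psi)$. Rules for both choices of $\bullet$: ($\bullet$Mon) if $\Gamma\vdash\bullet\phi$ and $\Delta\cup\{\phi\}\vdash\psi$ then $\Gamma\vdash\bullet\psi$. ($\bullet\lor$Distr) $\bullet(\phi\lor\psi)\,/\,\bullet\phi\lor\bullet\psi$.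 ($\bullet$I) $\alpha\,/\,\bullet\alpha$. ($\bullet_\neg$E) $\neg\alpha,\bullet\alpha\,/\,\phi$. ($\lor_\bullet$E) if $\Gamma\vdash\bullet\phi\lor\psi$, $\Gamma\cup\{\bullet\phi\}\vdash\chi$ and $\Gamma\cup\{\psi\}\vdash\chi$ then $\Gamma\vdash\chi$. ($\bullet$Distr) $\phi\lor\psi,\bullet\chi_1,\dots,\bullet\chi_n\,/\,((\phi\lor\chi_1\lor\dots\lor\chi_n)\land\bullet\chi_1\land\dots\land\bullet\chi_n)\lor\psi$. ($\Box\Diamond_\bullet$Exc) $\bullet\Diamond\psi,\Box\bullet\phi\,/\,\bullet\Diamond\phi$. ($\Diamond\Box_\bullet$Exc) $\bullet\Diamond\phi\,/\,\Box\bullet\phi$. ($\Box\lor_\bullet$E) if $\Gamma\vdash\Box(\bullet\phi\lor\psi)$, $\Gamma\cup\{\bullet\Diamond\phi\}\vdash\chi$ and $\Gamma\cup\{\Box\psi\}\vdash\chi$ then $\Gamma\vdash\chi$. ($\Diamond_\bullet$Distr) $\Diamond\bullet\phi\,/\,\bullet\Diamond\phi$. ($\bullet_\Diamond$Distr) $\Diamond\phi,\bullet\Diamond\psi_1,\dots,\bullet\Diamond\psi_n\,/\,\Diamond((\phi\lor\psi_1\lor\dots\lor\psi_n)\land\bullet\psi_1\land\dots\land\bullet\psi_n)$. *)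

theory Defs
  imports Main "HOL-Library.Countable_Set"
begin

datatype might_op = Might | SingMight

text \<open>Raw syntax shared by both languages: \<open>Bul Might\<close> is the might operator and
  \<open>Bul SingMight\<close> its singular variant. The predicates \<open>classical\<close> and \<open>in_ML\<close> below carve
  out the grammars; in particular negation is restricted to classical formulas there.\<close>

datatype 'p fm =
    Atom 'p
  | Bot
  | Neg "'p fm"
  | Or "'p fm" "'p fm"
  | And "'p fm" "'p fm"
  | Dia "'p fm"
  | Box "'p fm"
  | Bul might_op "'p fm"

primrec classical :: "'p fm \<Rightarrow> bool" where
  "classical (Atom p) \<longleftrightarrow> True"
| "classical Bot \<longleftrightarrow> True"
| "classical (Neg \<phi>) \<longleftrightarrow> classical \<phi>"
| "classical (Or \<phi> \<psi>) \<longleftrightarrow> classical \<phi> \<and> classical \<psi>"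
| "classical (And \<phi> \<psi>) \<longleftrightarrow> classical \<phi> \<and> classical \<psi>"
| "classical (Dia \<phi>) \<longleftrightarrow> classical \<phi>"
| "classical (Box \<phi>) \<longleftrightarrow> classical \<phi>"
| "classical (Bul c \<phi>) \<longleftrightarrow> False"

primrec in_ML :: "might_op \<Rightarrow> 'p fm \<Rightarrow> bool" where
  "in_ML b (Atom p) \<longleftrightarrow> True"
| "in_ML b Bot \<longleftrightarrow> True"
| "in_ML b (Neg \<phi>) \<longleftrightarrow> classical \<phi>"
| "in_ML b (Or \<phi> \<psi>) \<longleftrightarrow> in_ML b \<phi> \<and> in_ML b \<psi>"
| "in_ML b (And \<phi> \<psi>) \<longleftrightarrow> in_ML b \<phi> \<and> in_ML b \<psi>"
| "in_ML b (Dia \<phi>) \<longleftrightarrow> in_ML b \<phi>"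
| "in_ML b (Box \<phi>) \<longleftrightarrow> in_ML b \<phi>"
| "in_ML b (Bul c \<phi>) \<longleftrightarrow> c = b \<and> in_ML b \<phi>"

record ('p, 'w) kripke =
  worlds :: "'w set"
  rel :: "('w \<times> 'w) set"
  val :: "'p \<Rightarrow> 'w set"

definition kripke_model :: "('p, 'w) kripke \<Rightarrow> bool" where
  "kripke_model M \<longleftrightarrow>
     rel M \<subseteq> worlds M \<times> worlds M \<and> (\<forall>p. val M p \<subseteq> worlds M)"

definition team_succ :: "('w \<times> 'w) set \<Rightarrow> 'w set \<Rightarrow> 'w set \<Rightarrow> bool" where
  "team_succ R T S \<longleftrightarrow> S \<subseteq> R `` T \<and> T \<subseteq> R\<inverse> `` S"

primrec sat :: "('p, 'w) kripke \<Rightarrow> 'w set \<Rightarrow> 'p fm \<Rightarrow> bool" where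
  "sat M T (Atom p) \<longleftrightarrow> T \<subseteq> val M p"
| "sat M T Bot \<longleftrightarrow> T = {}"
| "sat M T (Neg \<alpha>) \<longleftrightarrow> (\<forall>w\<in>T. \<not> sat M {w} \<alpha>)"
| "sat M T (Or \<phi> \<psi>) \<longleftrightarrow> (\<exists>T1 T2. T = T1 \<union> T2 \<and> sat M T1 \<phi> \<and> sat M T2 \<psi>)"
| "sat M T (And \<phi> \<psi>) \<longleftrightarrow> sat M T \<phi> \<and> sat M T \<psi>"
| "sat M T (Dia \<phi>) \<longleftrightarrow> (\<exists>S. team_succ (rel M) T S \<and> sat M S \<phi>)"
| "sat M T (Box \<phi>) \<longleftrightarrow> sat M (rel M `` T) \<phi>"
| "sat M T (Bul c \<phi>) \<longleftrightarrow>
     (case c of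
        Might \<Rightarrow> T = {} \<or> (\<exists>S. S \<noteq> {} \<and> S \<subseteq> T \<and> sat M S \<phi>)
      | SingMight \<Rightarrow> T = {} \<or> (\<exists>w\<in>T. sat M {w} \<phi>))"

text \<open>Entailment over all models whose worlds form an arbitrary subset of the type \<open>'w\<close>.
  Since HOL has no quantification over types inside a formula, the universe of worlds is an
  explicit parameter.\<close>

definition entails :: "'w itself \<Rightarrow> 'p fm set \<Rightarrow> 'p fm \<Rightarrow> bool" where
  "entails (_ :: 'w itself) \<Gamma> \<phi> \<longleftrightarrow>
     (\<forall>(M :: ('p, 'w) kripke) T.
        kripke_model M \<longrightarrow> T \<subseteq> worlds M \<longrightarrow> (\<forall>\<gamma>\<in>\<Gamma>. sat M T \<gamma>) \<longrightarrow> sat M T \<phi>)"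

text \<open>Iterated connectives associate to the left and extend a given first member, so the
  empty list is harmless: \<open>Ors \<phi> [\<chi>\<^sub>1, \<dots>, \<chi>\<^sub>n]\<close> is \<open>\<phi> \<or> \<chi>\<^sub>1 \<or> \<dots> \<or> \<chi>\<^sub>n\<close>.\<close>

definition Ors :: "'p fm \<Rightarrow> 'p fm list \<Rightarrow> 'p fm" where
  "Ors \<phi> \<chi>s = foldl Or \<phi> \<chi>s"

definition Ands :: "'p fm \<Rightarrow> 'p fm list \<Rightarrow> 'p fm" where
  "Ands \<phi> \<chi>s = foldl And \<phi> \<chi>s"

text \<open>\<open>derives b \<Gamma> \<phi>\<close> is derivability in the system for the language of \<open>b\<close>.
  The \<open>in_ML\<close> premises occur exactly where a rule brings in a formula that is not
  determined by its premises; they keep derivations inside the language.\<close>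

inductive derives :: "might_op \<Rightarrow> 'p fm set \<Rightarrow> 'p fm \<Rightarrow> bool" for b :: might_op where
  Ax: "\<phi> \<in> \<Gamma> \<Longrightarrow> derives b \<Gamma> \<phi>"

| NegI: "\<lbrakk>\<Delta> \<subseteq> \<Gamma>; \<forall>\<delta>\<in>\<Delta>. classical \<delta>; classical \<alpha>; derives b (\<Delta> \<union> {\<alpha>}) Bot\<rbrakk>
    \<Longrightarrow> derives b \<Gamma> (Neg \<alpha>)"
| RAA: "\<lbrakk>\<Delta> \<subseteq> \<Gamma>; \<forall>\<delta>\<in>\<Delta>. classical \<delta>; classical \<alpha>; derives b (\<Delta> \<union> {Neg \<alpha>}) Bot\<rbrakk>
    \<Longrightarrow> derives b \<Gamma> \<alpha>"
| NegE: "\<lbrakk>classical \<alpha>; derives b \<Gamma> \<alpha>; derives b \<Gamma> (Neg \<alpha>); in_ML b \<phi>\<rbrakk> \<Longrightarrow> derives b \<Gamma> \<phi>"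
| OrI1: "\<lbrakk>derives b \<Gamma> \<phi>; in_ML b \<psi>\<rbrakk> \<Longrightarrow> derives b \<Gamma> (Or \<phi> \<psi>)"
| OrI2: "\<lbrakk>derives b \<Gamma> \<psi>; in_ML b \<phi>\<rbrakk> \<Longrightarrow> derives b \<Gamma> (Or \<phi> \<psi>)"
| OrE: "\<lbrakk>\<Delta> \<subseteq> \<Gamma>; \<forall>\<delta>\<in>\<Delta>. classical \<delta>; derives b \<Gamma> (Or \<phi> \<psi>);
      derives b (\<Delta> \<union> {\<phi>}) \<chi>; derives b (\<Delta> \<union> {\<psi>}) \<chi>\<rbrakk> \<Longrightarrow> derives b \<Gamma> \<chi>"
| AndI: "\<lbrakk>derives b \<Gamma> \<phi>; derives b \<Gamma> \<psi>\<rbrakk> \<Longrightarrow> derives b \<Gamma> (And \<phi> \<psi>)"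
| AndE1: "derives b \<Gamma> (And \<phi> \<psi>) \<Longrightarrow> derives b \<Gamma> \<phi>"
| AndE2: "derives b \<Gamma> (And \<phi> \<psi>) \<Longrightarrow> derives b \<Gamma> \<psi>"
| DiaBoxInter: "\<lbrakk>classical \<alpha>; derives b \<Gamma> (Neg (Box \<alpha>))\<rbrakk> \<Longrightarrow> derives b \<Gamma> (Dia (Neg \<alpha>))"
| BoxDiaInter: "\<lbrakk>classical \<alpha>; derives b \<Gamma> (Dia (Neg \<alpha>))\<rbrakk> \<Longrightarrow> derives b \<Gamma> (Neg (Box \<alpha>))"
| DiaOrDistr: "derives b \<Gamma> (Dia (Or \<phi> \<psi>)) \<Longrightarrow> derives b \<Gamma> (Or (Dia \<phi>) (Dia \<psi>))"
| BoxMon: "\<lbrakk>derives b (set \<phi>s) \<psi>; \<forall>\<phi>\<in>set \<phi>s. derives b \<Gamma> (Box \<phi>)\<rbrakk> \<Longrightarrow> derives b \<Gamma> (Box \<psi>)"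
| DiaMon: "\<lbrakk>derives b {\<phi>} \<psi>; derives b \<Gamma> (Dia \<phi>)\<rbrakk> \<Longrightarrow> derives b \<Gamma> (Dia \<psi>)"

| MightJoin: "\<lbrakk>b = Might; derives b \<Gamma> (Bul b \<phi>); derives b \<Gamma> (Bul b \<psi>)\<rbrakk>
    \<Longrightarrow> derives b \<Gamma> (Bul b (Ands (Or \<phi> \<psi>) [Bul b \<phi>, Bul b \<psi>]))"
| MightE: "\<lbrakk>b = Might; derives b \<Gamma> (Bul b (Bul b \<phi>))\<rbrakk> \<Longrightarrow> derives b \<Gamma> (Bul b \<phi>)"

| SingMightAndSimpl: "\<lbrakk>b = SingMight; derives b \<Gamma> (Bul b (And (Bul b \<phi>) \<psi>))\<rbrakk>
    \<Longrightarrow> derives b \<Gamma> (Bul b (And \<phi> \<psi>))"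

| BulMon: "\<lbrakk>\<Delta> \<subseteq> \<Gamma>; \<forall>\<delta>\<in>\<Delta>. classical \<delta>; derives b \<Gamma> (Bul b \<phi>); derives b (\<Delta> \<union> {\<phi>}) \<psi>\<rbrakk>
    \<Longrightarrow> derives b \<Gamma> (Bul b \<psi>)"
| BulOrDistr: "derives b \<Gamma> (Bul b (Or \<phi> \<psi>)) \<Longrightarrow> derives b \<Gamma> (Or (Bul b \<phi>) (Bul b \<psi>))"
| BulI: "\<lbrakk>classical \<alpha>; derives b \<Gamma> \<alpha>\<rbrakk> \<Longrightarrow> derives b \<Gamma> (Bul b \<alpha>)"
| BulNegE: "\<lbrakk>classical \<alpha>; derives b \<Gamma> (Neg \<alpha>); derives b \<Gamma> (Bul b \<alpha>); in_ML b \<phi>\<rbrakk>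
    \<Longrightarrow> derives b \<Gamma> \<phi>"
| OrBulE: "\<lbrakk>derives b \<Gamma> (Or (Bul b \<phi>) \<psi>); derives b (\<Gamma> \<union> {Bul b \<phi>}) \<chi>; derives b (\<Gamma> \<union> {\<psi>}) \<chi>\<rbrakk>
    \<Longrightarrow> derives b \<Gamma> \<chi>"
| BulDistr: "\<lbrakk>derives b \<Gamma> (Or \<phi> \<psi>); \<forall>\<chi>\<in>set \<chi>s. derives b \<Gamma> (Bul b \<chi>)\<rbrakk>
    \<Longrightarrow> derives b \<Gamma> (Or (Ands (Ors \<phi> \<chi>s) (map (Bul b) \<chi>s)) \<psi>)"
| BoxDiaBulExc: "\<lbrakk>derives b \<Gamma> (Bul b (Dia \<psi>)); derives b \<Gamma> (Box (Bul b \<phi>))\<rbrakk>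
    \<Longrightarrow> derives b \<Gamma> (Bul b (Dia \<phi>))"
| DiaBoxBulExc: "derives b \<Gamma> (Bul b (Dia \<phi>)) \<Longrightarrow> derives b \<Gamma> (Box (Bul b \<phi>))"
| BoxOrBulE: "\<lbrakk>derives b \<Gamma> (Box (Or (Bul b \<phi>) \<psi>)); derives b (\<Gamma> \<union> {Bul b (Dia \<phi>)}) \<chi>;
      derives b (\<Gamma> \<union> {Box \<psi>}) \<chi>\<rbrakk> \<Longrightarrow> derives b \<Gamma> \<chi>"
| DiaBulDistr: "derives b \<Gamma> (Dia (Bul b \<phi>)) \<Longrightarrow> derives b \<Gamma> (Bul b (Dia \<phi>))"
| BulDiaDistr: "\<lbrakk>derives b \<Gamma> (Dia \<phi>); \<forall>\<psi>\<in>set \<psi>s. derives b \<Gamma> (Bul b (Dia \<psi>))\<rbrakk>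
    \<Longrightarrow> derives b \<Gamma> (Dia (Ands (Ors \<phi> \<psi>s) (map (Bul b) \<psi>s)))"

end

theory Submission
  imports Defs
begin

text \<open>
  The proof rests on a normal form. Split disjunction and the modalities quantify over teams, so a
  formula is not determined by its behaviour at single worlds. Nevertheless every formula is
  equivalent to a finite \<^emph>\<open>Boolean\<close> disjunction of clauses \<open>\<alpha> \<and> \<nabla>\<beta>\<^sub>1 \<and> \<dots> \<and> \<nabla>\<beta>\<^sub>n\<close> whose
  entries are classical, and such a clause only says that \<open>\<alpha>\<close> holds at all worlds of the team and
  each \<open>\<beta>\<^sub>i\<close> at some world. Boolean disjunction is not a connective of the language. On the side
  of derivations it therefore appears as a principle of case distinction (\<open>derives_normal\<close>), and
  on the side of teams as the existence of a satisfied clause (\<open>sat_normal\<close>); the theorem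
  \<open>normal_form\<close> gives both for the same list of clauses.

  The normal form is computed connective by connective. The main step is to read a split
  disjunction of clauses as a Boolean one: a team that splits along the clauses of a list uses
  some of them on nonempty parts, and the team can be described by a single clause (\<open>merge\<close>) once
  it is known which. The rule that eliminates \<open>\<nabla>\<phi> \<or> \<psi>\<close> with arbitrary side assumptions provides
  the case distinction (\<open>split_cases\<close>), and the distribution rule for \<open>\<nabla>\<close> recovers the split
  disjunction from the merged clause (\<open>merge_elim\<close>).

  Now suppose that \<open>\<Gamma>\<close> does not derive \<open>\<psi>\<close>, and let \<open>\<Delta> \<supseteq> \<Gamma>\<close> be maximal among the sets of formulas
  of the language that do not derive \<open>\<psi>\<close>. By maximality, \<open>\<nabla>\<phi> \<or> \<chi> \<in> \<Delta>\<close> implies \<open>\<nabla>\<phi> \<in> \<Delta>\<close> or \<open>\<chi> \<in> \<Delta>\<close>.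
  Applied to the derivable \<open>\<nabla>\<not>\<alpha> \<or> \<alpha>\<close> this shows that the classical part of \<open>\<Delta>\<close> is complete in the
  sense that for each classical \<open>\<alpha>\<close> either \<open>\<alpha> \<in> \<Delta>\<close> or \<open>\<nabla>\<not>\<alpha> \<in> \<Delta>\<close>. Choose for every \<open>\<nabla>\<beta> \<in> \<Delta>\<close> with
  classical \<open>\<beta>\<close> a maximal consistent set of classical formulas that contains \<open>\<beta>\<close> and the classical
  part of \<open>\<Delta>\<close>. In a canonical model the team of these sets satisfies exactly those classical \<open>\<alpha>\<close>
  and those \<open>\<nabla>\<beta>\<close> that belong to \<open>\<Delta>\<close>, hence by the normal form exactly the members of \<open>\<Delta>\<close>: it
  satisfies \<open>\<Gamma>\<close> and not \<open>\<psi>\<close>. As there are only countably many formulas, closing the team under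
  chosen successors gives a countable model, whose worlds can be taken from any infinite type.

  All of this manipulates derivations freely and so requires cut. Since several rules admit only
  classical side assumptions, cut is not immediate; the theorem \<open>cut\<close> shows it admissible.
\<close>

section \<open>Derivability: weakening, finiteness, cut\<close>

lemma classical_in_ML: "classical \<phi> \<Longrightarrow> in_ML b \<phi>"
  by (induction \<phi>) auto

lemma Ors_simps [simp]: "Ors \<phi> [] = \<phi>" "Ors \<phi> (\<chi> # \<chi>s) = Ors (Or \<phi> \<chi>) \<chi>s"
    "Ors \<phi> (\<chi>s @ [\<chi>]) = Or (Ors \<phi> \<chi>s) \<chi>"
  by (simp_all add: Ors_def)

lemma Ands_simps [simp]: "Ands \<phi> [] = \<phi>" "Ands \<phi> (\<chi> # \<chi>s) = Ands (And \<phi> \<chi>) \<chi>s"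
    "Ands \<phi> (\<chi>s @ [\<chi>]) = And (Ands \<phi> \<chi>s) \<chi>"
  by (simp_all add: Ands_def)

lemma in_ML_Ors [simp]: "in_ML b (Ors \<phi> \<chi>s) \<longleftrightarrow> in_ML b \<phi> \<and> (\<forall>\<chi>\<in>set \<chi>s. in_ML b \<chi>)"
  by (induction \<chi>s arbitrary: \<phi>) auto

lemma in_ML_Ands [simp]: "in_ML b (Ands \<phi> \<chi>s) \<longleftrightarrow> in_ML b \<phi> \<and> (\<forall>\<chi>\<in>set \<chi>s. in_ML b \<chi>)"
  by (induction \<chi>s arbitrary: \<phi>) auto

lemma classical_Ors [simp]: "classical (Ors \<phi> \<chi>s) \<longleftrightarrow> classical \<phi> \<and> (\<forall>\<chi>\<in>set \<chi>s. classical \<chi>)"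
  by (induction \<chi>s arbitrary: \<phi>) auto

lemma classical_Ands [simp]: "classical (Ands \<phi> \<chi>s) \<longleftrightarrow> classical \<phi> \<and> (\<forall>\<chi>\<in>set \<chi>s. classical \<chi>)"
  by (induction \<chi>s arbitrary: \<phi>) auto

locale might_logic =
  fixes b :: might_op
begin

abbreviation derivable :: "'p fm set \<Rightarrow> 'p fm \<Rightarrow> bool" (infix "\<turnstile>" 45)
  where "\<Gamma> \<turnstile> \<phi> \<equiv> derives b \<Gamma> \<phi>"

abbreviation might :: "'p fm \<Rightarrow> 'p fm" ("\<nabla> _" [90] 90)
  where "\<nabla> \<phi> \<equiv> Bul b \<phi>"

abbreviation language :: "'p fm set"
  where "language \<equiv> {\<phi>. in_ML b \<phi>}"

text \<open>Assumption sets are written with \<open>insert\<close> throughout, the form to which the simplifier brings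
  the unions in the discharging rules.\<close>

lemmas NegI' = derives.NegI[where b = b, unfolded Un_insert_right Un_empty_right]
  and RAA' = derives.RAA[where b = b, unfolded Un_insert_right Un_empty_right]
  and OrE' = derives.OrE[where b = b, unfolded Un_insert_right Un_empty_right]
  and BulMon' = derives.BulMon[where b = b, unfolded Un_insert_right Un_empty_right]
  and OrBulE' = derives.OrBulE[where b = b, unfolded Un_insert_right Un_empty_right]
  and BoxOrBulE' = derives.BoxOrBulE[where b = b, unfolded Un_insert_right Un_empty_right]

lemma weakening: "\<Gamma> \<turnstile> \<phi> \<Longrightarrow> \<Gamma> \<subseteq> \<Gamma>' \<Longrightarrow> \<Gamma>' \<turnstile> \<phi>"
proof (induction arbitrary: \<Gamma>' rule: derives.induct)
  case (NegI \<Delta> \<Gamma> \<alpha>)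
  show ?case by (rule derives.NegI[OF _ NegI.hyps(2-4)]) (use NegI.hyps(1) NegI.prems in blast)
next
  case (RAA \<Delta> \<Gamma> \<alpha>)
  show ?case by (rule derives.RAA[OF _ RAA.hyps(2-4)]) (use RAA.hyps(1) RAA.prems in blast)
next
  case (OrE \<Delta> \<Gamma> \<phi> \<psi> \<chi>)
  show ?case
    by (rule derives.OrE[OF _ OrE.hyps(2) OrE.IH(1)[OF OrE.prems] OrE.hyps(4,5)])
      (use OrE.hyps(1) OrE.prems in blast)
next
  case (BulMon \<Delta> \<Gamma> \<phi> \<psi>)
  show ?case
    by (rule derives.BulMon[OF _ BulMon.hyps(2) BulMon.IH(1)[OF BulMon.prems] BulMon.hyps(4)])
      (use BulMon.hyps(1) BulMon.prems in blast)
next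
  case (OrBulE \<Gamma> \<phi> \<psi> \<chi>)
  show ?case by (rule OrBulE'[of _ \<phi> \<psi>]) (intro OrBulE.IH; use OrBulE.prems in blast)+
next
  case (BoxOrBulE \<Gamma> \<phi> \<psi> \<chi>)
  show ?case by (rule BoxOrBulE'[of _ \<phi> \<psi>]) (intro BoxOrBulE.IH; use BoxOrBulE.prems in blast)+
next
  case (NegE \<alpha> \<Gamma> \<phi>) show ?case by (rule derives.NegE[of \<alpha>]) (use NegE in blast)+
next
  case (AndE1 \<Gamma> \<phi> \<psi>) show ?case by (rule derives.AndE1[of _ _ \<phi> \<psi>]) (use AndE1 in blast)+
next
  case (AndE2 \<Gamma> \<phi> \<psi>) show ?case by (rule derives.AndE2[of _ _ \<phi> \<psi>]) (use AndE2 in blast)+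
next
  case (BoxMon \<phi>s \<psi> \<Gamma>) show ?case by (rule derives.BoxMon[of _ \<phi>s]) (use BoxMon in blast)+
next
  case (DiaMon \<phi> \<psi> \<Gamma>) show ?case by (rule derives.DiaMon[of _ \<phi>]) (use DiaMon in blast)+
next
  case (BoxDiaBulExc \<Gamma> \<psi> \<phi>)
  show ?case by (rule derives.BoxDiaBulExc[of _ _ \<psi>]) (use BoxDiaBulExc in blast)+
next
  case (BulNegE \<alpha> \<Gamma> \<phi>) show ?case by (rule derives.BulNegE[of \<alpha>]) (use BulNegE in blast)+
next
  case (Ax \<phi> \<Gamma>) then show ?case by (auto intro: derives.Ax)
next
  case OrI1 show ?case by (rule derives.OrI1) (use OrI1 in blast)+
next
  case OrI2 show ?case by (rule derives.OrI2) (use OrI2 in blast)+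
next
  case AndI show ?case by (rule derives.AndI) (use AndI in blast)+
next
  case DiaBoxInter show ?case by (rule derives.DiaBoxInter) (use DiaBoxInter in blast)+
next
  case BoxDiaInter show ?case by (rule derives.BoxDiaInter) (use BoxDiaInter in blast)+
next
  case DiaOrDistr show ?case by (rule derives.DiaOrDistr) (use DiaOrDistr in blast)+
next
  case MightJoin show ?case by (rule derives.MightJoin) (use MightJoin in blast)+
next
  case MightE show ?case by (rule derives.MightE) (use MightE in blast)+
next
  case SingMightAndSimpl
  show ?case by (rule derives.SingMightAndSimpl) (use SingMightAndSimpl in blast)+
next
  case BulOrDistr show ?case by (rule derives.BulOrDistr) (use BulOrDistr in blast)+
next
  case BulI show ?case by (rule derives.BulI) (use BulI in blast)+
next
  case BulDistr show ?case by (rule derives.BulDistr) (use BulDistr in blast)+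
next
  case DiaBoxBulExc show ?case by (rule derives.DiaBoxBulExc) (use DiaBoxBulExc in blast)+
next
  case DiaBulDistr show ?case by (rule derives.DiaBulDistr) (use DiaBulDistr in blast)+
next
  case BulDiaDistr show ?case by (rule derives.BulDiaDistr) (use BulDiaDistr in blast)+
qed

lemma language_closed: "\<Gamma> \<turnstile> \<phi> \<Longrightarrow> \<Gamma> \<subseteq> language \<Longrightarrow> in_ML b \<phi>"
proof (induction rule: derives.induct)
  case (OrE \<Delta> \<Gamma> \<phi> \<psi> \<chi>)
  then have "\<Delta> \<union> {\<phi>} \<subseteq> language" by auto
  with OrE show ?case by blast
next
  case (BulMon \<Delta> \<Gamma> \<phi> \<psi>)
  then have "\<Delta> \<union> {\<phi>} \<subseteq> language" by auto
  with BulMon show ?case by auto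
next
  case (BoxMon \<phi>s \<psi> \<Gamma>)
  then have "set \<phi>s \<subseteq> language" by auto
  with BoxMon show ?case by auto
qed (auto simp: classical_in_ML)

text \<open>Compactness of derivability has two uses: Zorn's lemma needs it for the maximal sets of the
  completeness proof, and it reduces the side formulas of a rule to a finite list.\<close>

definition fin_derivable :: "'p fm set \<Rightarrow> 'p fm \<Rightarrow> bool"
  where "fin_derivable \<Gamma> \<phi> \<longleftrightarrow> (\<exists>\<Gamma>0\<subseteq>\<Gamma>. finite \<Gamma>0 \<and> \<Gamma>0 \<turnstile> \<phi>)"

lemma fin_common:
  assumes "finite A" and "\<And>\<phi>. \<phi> \<in> A \<Longrightarrow> fin_derivable \<Gamma> \<phi>"
  shows "\<exists>\<Gamma>0\<subseteq>\<Gamma>. finite \<Gamma>0 \<and> (\<forall>\<phi>\<in>A. \<Gamma>0 \<turnstile> \<phi>)"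
proof -
  have "\<exists>f. \<forall>\<phi>\<in>A. f \<phi> \<subseteq> \<Gamma> \<and> finite (f \<phi>) \<and> f \<phi> \<turnstile> \<phi>"
    using assms(2) unfolding fin_derivable_def by (intro bchoice) blast
  then obtain f where f: "\<forall>\<phi>\<in>A. f \<phi> \<subseteq> \<Gamma> \<and> finite (f \<phi>) \<and> f \<phi> \<turnstile> \<phi>" ..
  show ?thesis
    by (rule exI[of _ "\<Union>(f ` A)"]) (use f assms(1) weakening in blast)
qed

lemma fin_rule:
  assumes "finite A" and "\<And>\<phi>. \<phi> \<in> A \<Longrightarrow> fin_derivable \<Gamma> \<phi>"
    and "\<And>\<Gamma>0. \<lbrakk>\<Gamma>0 \<subseteq> \<Gamma>; \<forall>\<phi>\<in>A. \<Gamma>0 \<turnstile> \<phi>\<rbrakk> \<Longrightarrow> \<Gamma>0 \<turnstile> \<psi>"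
  shows "fin_derivable \<Gamma> \<psi>"
  using fin_common[OF assms(1,2)] assms(3) unfolding fin_derivable_def by blast

lemma fin_unary:
  "fin_derivable \<Gamma> \<phi> \<Longrightarrow> (\<And>\<Gamma>0. \<Gamma>0 \<turnstile> \<phi> \<Longrightarrow> \<Gamma>0 \<turnstile> \<psi>) \<Longrightarrow> fin_derivable \<Gamma> \<psi>"
  unfolding fin_derivable_def by blast

lemma fin_discharge:
  assumes "fin_derivable (\<Delta> \<union> {\<phi>}) \<psi>"
  obtains \<Delta>0 where "\<Delta>0 \<subseteq> \<Delta>" "finite \<Delta>0" "insert \<phi> \<Delta>0 \<turnstile> \<psi>"
proof -
  obtain \<Gamma>0 where G: "\<Gamma>0 \<subseteq> insert \<phi> \<Delta>" "finite \<Gamma>0" "\<Gamma>0 \<turnstile> \<psi>"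
    using assms unfolding fin_derivable_def by blast
  show thesis
    by (rule that[of "\<Gamma>0 - {\<phi>}"]) (use G in \<open>auto intro: weakening\<close>)
qed

lemma finite_support: "\<Gamma> \<turnstile> \<phi> \<Longrightarrow> fin_derivable \<Gamma> \<phi>"
proof (induction rule: derives.induct)
  case (Ax \<phi> \<Gamma>)
  then show ?case unfolding fin_derivable_def
    by (intro exI[of _ "{\<phi>}"]) (auto intro: derives.Ax)
next
  case (NegI \<Delta> \<Gamma> \<alpha>)
  obtain \<Delta>0 where "\<Delta>0 \<subseteq> \<Delta>" "finite \<Delta>0" "insert \<alpha> \<Delta>0 \<turnstile> Bot"
    using fin_discharge NegI.IH by metis
  with NegI show ?case unfolding fin_derivable_def
    by (intro exI[of _ \<Delta>0]) (auto intro: NegI'[of \<Delta>0])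
next
  case (RAA \<Delta> \<Gamma> \<alpha>)
  obtain \<Delta>0 where "\<Delta>0 \<subseteq> \<Delta>" "finite \<Delta>0" "insert (Neg \<alpha>) \<Delta>0 \<turnstile> Bot"
    using fin_discharge RAA.IH by metis
  with RAA show ?case unfolding fin_derivable_def
    by (intro exI[of _ \<Delta>0]) (auto intro: RAA'[of \<Delta>0])
next
  case (OrE \<Delta> \<Gamma> \<phi> \<psi> \<chi>)
  obtain \<Delta>1 where 1: "\<Delta>1 \<subseteq> \<Delta>" "finite \<Delta>1" "insert \<phi> \<Delta>1 \<turnstile> \<chi>"
    using fin_discharge OrE.IH by metis
  obtain \<Delta>2 where 2: "\<Delta>2 \<subseteq> \<Delta>" "finite \<Delta>2" "insert \<psi> \<Delta>2 \<turnstile> \<chi>"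
    using fin_discharge OrE.IH by metis
  obtain \<Gamma>0 where 3: "\<Gamma>0 \<subseteq> \<Gamma>" "finite \<Gamma>0" "\<Gamma>0 \<turnstile> Or \<phi> \<psi>"
    using OrE.IH unfolding fin_derivable_def by blast
  have "\<Gamma>0 \<union> \<Delta>1 \<union> \<Delta>2 \<turnstile> \<chi>"
    by (rule OrE'[of "\<Delta>1 \<union> \<Delta>2" _ \<phi> \<psi>])
      (use 1 2 3 OrE.hyps in \<open>auto intro: weakening\<close>)
  then show ?case unfolding fin_derivable_def
    using 1 2 3 OrE.hyps by (intro exI[of _ "\<Gamma>0 \<union> \<Delta>1 \<union> \<Delta>2"]) auto
next
  case (BulMon \<Delta> \<Gamma> \<phi> \<psi>)
  obtain \<Delta>1 where 1: "\<Delta>1 \<subseteq> \<Delta>" "finite \<Delta>1" "insert \<phi> \<Delta>1 \<turnstile> \<psi>"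
    using fin_discharge BulMon.IH by metis
  obtain \<Gamma>0 where 3: "\<Gamma>0 \<subseteq> \<Gamma>" "finite \<Gamma>0" "\<Gamma>0 \<turnstile> \<nabla> \<phi>"
    using BulMon.IH unfolding fin_derivable_def by blast
  have "\<Gamma>0 \<union> \<Delta>1 \<turnstile> \<nabla> \<psi>"
    by (rule BulMon'[of "\<Delta>1" _ \<phi>])
      (use 1 3 BulMon.hyps in \<open>auto intro: weakening\<close>)
  then show ?case unfolding fin_derivable_def
    using 1 3 BulMon.hyps by (intro exI[of _ "\<Gamma>0 \<union> \<Delta>1"]) auto
next
  case (OrBulE \<Gamma> \<phi> \<psi> \<chi>)
  obtain \<Delta>1 where 1: "\<Delta>1 \<subseteq> \<Gamma>" "finite \<Delta>1" "insert (\<nabla> \<phi>) \<Delta>1 \<turnstile> \<chi>"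
    using fin_discharge OrBulE.IH by metis
  obtain \<Delta>2 where 2: "\<Delta>2 \<subseteq> \<Gamma>" "finite \<Delta>2" "insert \<psi> \<Delta>2 \<turnstile> \<chi>"
    using fin_discharge OrBulE.IH by metis
  obtain \<Gamma>0 where 3: "\<Gamma>0 \<subseteq> \<Gamma>" "finite \<Gamma>0" "\<Gamma>0 \<turnstile> Or (\<nabla> \<phi>) \<psi>"
    using OrBulE.IH unfolding fin_derivable_def by blast
  have "\<Gamma>0 \<union> \<Delta>1 \<union> \<Delta>2 \<turnstile> \<chi>"
    by (rule OrBulE'[of _ \<phi> \<psi>])
      (use 1 2 3 in \<open>auto intro: weakening\<close>)
  then show ?case unfolding fin_derivable_def
    using 1 2 3 by (intro exI[of _ "\<Gamma>0 \<union> \<Delta>1 \<union> \<Delta>2"]) auto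
next
  case (BoxOrBulE \<Gamma> \<phi> \<psi> \<chi>)
  obtain \<Delta>1 where 1: "\<Delta>1 \<subseteq> \<Gamma>" "finite \<Delta>1" "insert (\<nabla> (Dia \<phi>)) \<Delta>1 \<turnstile> \<chi>"
    using fin_discharge BoxOrBulE.IH by metis
  obtain \<Delta>2 where 2: "\<Delta>2 \<subseteq> \<Gamma>" "finite \<Delta>2" "insert (Box \<psi>) \<Delta>2 \<turnstile> \<chi>"
    using fin_discharge BoxOrBulE.IH by metis
  obtain \<Gamma>0 where 3: "\<Gamma>0 \<subseteq> \<Gamma>" "finite \<Gamma>0" "\<Gamma>0 \<turnstile> Box (Or (\<nabla> \<phi>) \<psi>)"
    using BoxOrBulE.IH unfolding fin_derivable_def by blast
  have "\<Gamma>0 \<union> \<Delta>1 \<union> \<Delta>2 \<turnstile> \<chi>"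
    by (rule BoxOrBulE'[of _ \<phi> \<psi>])
      (use 1 2 3 in \<open>auto intro: weakening\<close>)
  then show ?case unfolding fin_derivable_def
    using 1 2 3 by (intro exI[of _ "\<Gamma>0 \<union> \<Delta>1 \<union> \<Delta>2"]) auto
next
  case (BoxMon \<phi>s \<psi> \<Gamma>)
  show ?case
    by (rule fin_rule[of "Box ` set \<phi>s"]) (use BoxMon in \<open>auto intro: derives.BoxMon[of _ \<phi>s]\<close>)
next
  case (BulDistr \<Gamma> \<phi> \<psi> \<chi>s)
  show ?case
    by (rule fin_rule[of "insert (Or \<phi> \<psi>) ((\<lambda>\<chi>. \<nabla> \<chi>) ` set \<chi>s)"])
      (use BulDistr in \<open>auto intro: derives.BulDistr\<close>)
next
  case (BulDiaDistr \<Gamma> \<phi> \<psi>s)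
  show ?case
    by (rule fin_rule[of "insert (Dia \<phi>) ((\<lambda>\<psi>. \<nabla> (Dia \<psi>)) ` set \<psi>s)"])
      (use BulDiaDistr in \<open>auto intro: derives.BulDiaDistr\<close>)
next
  case (NegE \<alpha> \<Gamma> \<phi>)
  show ?case by (rule fin_rule[of "{\<alpha>, Neg \<alpha>}"]) (use NegE in \<open>auto intro: derives.NegE[of \<alpha>]\<close>)
next
  case (AndI \<Gamma> \<phi> \<psi>)
  show ?case by (rule fin_rule[of "{\<phi>,\<psi>}"]) (use AndI in \<open>auto intro: derives.intros\<close>)
next
  case (MightJoin \<Gamma> \<phi> \<psi>)
  show ?case
    by (rule fin_rule[of "{\<nabla> \<phi>,\<nabla> \<psi>}"]) 
      (use MightJoin in \<open>auto intro: derives.MightJoin simp del: Ands_simps\<close>)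
next
  case (BulNegE \<alpha> \<Gamma> \<phi>)
  show ?case by (rule fin_rule[of "{Neg \<alpha>, \<nabla> \<alpha>}"]) (use BulNegE in \<open>auto intro: derives.BulNegE[of \<alpha>]\<close>)
next
  case (BoxDiaBulExc \<Gamma> \<psi> \<phi>)
  show ?case
    by (rule fin_rule[of "{\<nabla> (Dia \<psi>), Box (\<nabla> \<phi>)}"])
      (use BoxDiaBulExc in \<open>auto intro: derives.BoxDiaBulExc\<close>)
next
  case (DiaMon \<phi> \<psi> \<Gamma>) 
  show ?case by (rule fin_rule[of "{Dia \<phi>}"]) (use DiaMon in \<open>auto intro: derives.DiaMon\<close>)
qed (erule fin_unary, (rule derives.OrI1 derives.OrI2 derives.AndE1 derives.AndE2
  derives.DiaBoxInter derives.BoxDiaInter derives.DiaOrDistr derives.MightE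
  derives.SingMightAndSimpl derives.BulOrDistr derives.BulI derives.DiaBoxBulExc
  derives.DiaBulDistr; assumption))+

lemma explode:
  assumes "\<Gamma> \<turnstile> Bot" "in_ML b \<phi>" shows "\<Gamma> \<turnstile> \<phi>"
proof -
  have "\<Gamma> \<turnstile> Neg Bot" by (rule NegI'[of "{}"]) (auto intro: derives.Ax)
  from derives.NegE[OF _ assms(1) this assms(2)] show ?thesis by simp
qed

lemma or_elim: "\<Gamma> \<turnstile> Or \<phi> \<psi> \<Longrightarrow> {\<phi>} \<turnstile> \<chi> \<Longrightarrow> {\<psi>} \<turnstile> \<chi> \<Longrightarrow> \<Gamma> \<turnstile> \<chi>"
  by (rule OrE'[of "{}" \<Gamma> \<phi> \<psi>]) simp_all

text \<open>Disjunction elimination without side formulas, applied to \<open>\<phi> \<or> \<phi>\<close>, is a cut in which \<open>\<phi>\<close> is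
  the only assumption of the second derivation. The assumptions \<open>\<Gamma>\<close> may then be nonclassical.\<close>

lemma cut_single: "\<Gamma> \<turnstile> \<phi> \<Longrightarrow> {\<phi>} \<turnstile> \<chi> \<Longrightarrow> in_ML b \<phi> \<Longrightarrow> \<Gamma> \<turnstile> \<chi>"
  by (rule or_elim[OF derives.OrI1])

lemma contradiction:
  assumes "\<alpha> \<in> \<Gamma>" "Neg \<alpha> \<in> \<Gamma>" "classical \<alpha>" "in_ML b \<phi>"
  shows "\<Gamma> \<turnstile> \<phi>"
  by (rule derives.NegE[OF assms(3) derives.Ax derives.Ax]) (use assms in simp_all)

lemma top: "\<Gamma> \<turnstile> Neg Bot"
  by (rule NegI'[of "{}"]) (auto intro: derives.Ax)

lemma excluded_middle:
  assumes "classical \<alpha>" shows "\<Gamma> \<turnstile> Or (Neg \<alpha>) \<alpha>"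
proof -
  let ?X = "Or (Neg \<alpha>) \<alpha>"
  have X: "classical ?X" "in_ML b \<alpha>" "in_ML b ?X" using assms by (simp_all add: classical_in_ML)
  have "{\<alpha>, Neg ?X} \<turnstile> ?X"
    by (rule derives.OrI2[OF derives.Ax]) (use assms in auto)
  then have "{\<alpha>, Neg ?X} \<turnstile> Bot"
    by (rule derives.NegE[OF X(1) _ derives.Ax]) simp_all
  with assms have "{Neg ?X} \<turnstile> Neg \<alpha>"
    by - (rule NegI'[of "{Neg ?X}"], simp_all)
  then have "{Neg ?X} \<turnstile> ?X"
    by (rule derives.OrI1) (use X in simp)
  then have "{Neg ?X} \<turnstile> Bot"
    by (rule derives.NegE[OF X(1) _ derives.Ax]) simp_all
  with X show ?thesis
    by - (rule RAA'[of "{}"], simp_all)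
qed

lemma double_negI: "classical \<alpha> \<Longrightarrow> {\<alpha>} \<turnstile> Neg (Neg \<alpha>)"
  by (rule NegI'[of "{\<alpha>}"]) (simp_all add: contradiction[of \<alpha>])

lemma double_negE: "classical \<alpha> \<Longrightarrow> {Neg (Neg \<alpha>)} \<turnstile> \<alpha>"
  by (rule RAA'[of "{Neg (Neg \<alpha>)}"]) (simp_all add: contradiction[of "Neg \<alpha>"])

text \<open>A team either contains a world that refutes \<open>\<alpha>\<close>, or satisfies \<open>\<alpha>\<close>. This form of the excluded
  middle has a disjunct \<open>\<nabla> (Neg \<alpha>)\<close>, so it supports case distinctions with arbitrary side
  assumptions.\<close>

lemma might_neg_or:
  assumes "classical \<alpha>" shows "\<Gamma> \<turnstile> Or (\<nabla> (Neg \<alpha>)) \<alpha>"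
proof (rule or_elim[OF excluded_middle[OF assms]])
  have "{Neg \<alpha>} \<turnstile> \<nabla> (Neg \<alpha>)"
    by (rule derives.BulI[OF _ derives.Ax]) (use assms in simp_all)
  then show "{Neg \<alpha>} \<turnstile> Or (\<nabla> (Neg \<alpha>)) \<alpha>"
    by (rule derives.OrI1) (use assms in \<open>simp add: classical_in_ML\<close>)
  show "{\<alpha>} \<turnstile> Or (\<nabla> (Neg \<alpha>)) \<alpha>"
    by (rule derives.OrI2[OF derives.Ax]) (use assms in simp_all)
qed

text \<open>\<open>guarded ds \<chi>\<close> says that \<open>\<chi>\<close> holds unless some formula of \<open>ds\<close> fails at some world. Classical
  side assumptions \<open>ds\<close> of a derivation can be traded for such a guard, which passes through
  rules that admit no side assumptions and is discharged afterwards, where \<open>ds\<close> is derivable.\<close>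

definition guarded :: "'p fm list \<Rightarrow> 'p fm \<Rightarrow> 'p fm"
  where "guarded ds \<chi> = foldr (\<lambda>d. Or (\<nabla> (Neg d))) ds \<chi>"

lemma guarded_simps [simp]:
  "guarded [] \<chi> = \<chi>" "guarded (d # ds) \<chi> = Or (\<nabla> (Neg d)) (guarded ds \<chi>)"
  by (simp_all add: guarded_def)

lemma in_ML_guarded [simp]: "in_ML b (guarded ds \<chi>) \<longleftrightarrow> (\<forall>d\<in>set ds. classical d) \<and> in_ML b \<chi>"
  by (induction ds) auto

lemma guardedI:
  "\<Gamma> \<union> set ds \<turnstile> \<chi> \<Longrightarrow> \<forall>d\<in>set ds. classical d \<Longrightarrow> in_ML b \<chi> \<Longrightarrow> \<Gamma> \<turnstile> guarded ds \<chi>"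
proof (induction ds arbitrary: \<Gamma>)
  case (Cons d ds)
  have "insert d \<Gamma> \<turnstile> guarded ds \<chi>"
    using Cons.prems by (intro Cons.IH) simp_all
  then have 2: "insert d \<Gamma> \<turnstile> Or (\<nabla> (Neg d)) (guarded ds \<chi>)"
    by (rule derives.OrI2) (use Cons.prems in simp)
  have 1: "insert (\<nabla> (Neg d)) \<Gamma> \<turnstile> Or (\<nabla> (Neg d)) (guarded ds \<chi>)"
    by (rule derives.OrI1[OF derives.Ax]) (use Cons.prems in simp_all)
  have "\<Gamma> \<turnstile> Or (\<nabla> (Neg d)) (guarded ds \<chi>)"
    by (rule OrBulE'[OF might_neg_or 1 2]) (use Cons.prems in simp)
  then show ?case by simp
qed simp

lemma guard_elim:
  assumes "\<Gamma> \<turnstile> Or (\<nabla> (Neg d)) \<chi>" "\<Gamma> \<turnstile> d" "classical d" "in_ML b \<chi>"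
  shows "\<Gamma> \<turnstile> \<chi>"
proof (rule OrBulE'[OF assms(1)])
  have "insert (\<nabla> (Neg d)) \<Gamma> \<turnstile> d"
    using assms(2) by (rule weakening) blast
  then have "insert (\<nabla> (Neg d)) \<Gamma> \<turnstile> Neg (Neg d)"
    by (rule cut_single[OF _ double_negI]) (simp_all add: assms classical_in_ML)
  then show "insert (\<nabla> (Neg d)) \<Gamma> \<turnstile> \<chi>"
    by (rule derives.BulNegE[rotated, OF _ derives.Ax]) (simp_all add: assms)
qed (simp add: derives.Ax)

lemma guardedE:
  "\<Gamma> \<turnstile> guarded ds \<chi> \<Longrightarrow> \<forall>d\<in>set ds. classical d \<and> \<Gamma> \<turnstile> d \<Longrightarrow> in_ML b \<chi> \<Longrightarrow> \<Gamma> \<turnstile> \<chi>"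
proof (induction ds)
  case (Cons d ds)
  have "\<Gamma> \<turnstile> guarded ds \<chi>"
    by (rule guard_elim[of _ d]) (use Cons.prems in simp_all)
  then show ?case using Cons by simp
qed simp

lemma might_mono: "\<Gamma> \<turnstile> \<nabla> \<phi> \<Longrightarrow> {\<phi>} \<turnstile> \<psi> \<Longrightarrow> \<Gamma> \<turnstile> \<nabla> \<psi>"
  by (rule BulMon'[of "{}" _ \<phi>]) simp_all

text \<open>For the singular operator the two occurrences of \<open>\<nabla>\<close> are merged by its conjunction rule, for
  which a trivial second conjunct is supplied.\<close>

lemma might_might:
  assumes "\<Gamma> \<turnstile> \<nabla> (\<nabla> \<phi>)" shows "\<Gamma> \<turnstile> \<nabla> \<phi>"
proof (cases b)
  case Might
  then show ?thesis using assms by (rule derives.MightE)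
next
  case SingMight
  have "\<Gamma> \<turnstile> \<nabla> (And (\<nabla> \<phi>) (Neg Bot))"
    using assms by (rule might_mono) (rule derives.AndI[OF derives.Ax top], simp)
  with SingMight have "\<Gamma> \<turnstile> \<nabla> (And \<phi> (Neg Bot))"
    by (rule derives.SingMightAndSimpl)
  then show ?thesis
    by (rule might_mono) (rule derives.AndE1[OF derives.Ax], simp)
qed

lemma might_guardedE:
  "\<Gamma> \<turnstile> \<nabla> (guarded ds \<chi>) \<Longrightarrow> \<forall>d\<in>set ds. classical d \<and> \<Gamma> \<turnstile> d \<Longrightarrow> in_ML b \<chi> \<Longrightarrow> \<Gamma> \<turnstile> \<nabla> \<chi>"
proof (induction ds)
  case (Cons d ds)
  have "\<Gamma> \<turnstile> Or (\<nabla> (\<nabla> (Neg d))) (\<nabla> (guarded ds \<chi>))"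
    by (rule derives.BulOrDistr) (use Cons.prems in simp)
  moreover have "{\<nabla> (\<nabla> (Neg d))} \<turnstile> Or (\<nabla> (Neg d)) (\<nabla> (guarded ds \<chi>))"
    by (rule derives.OrI1[OF might_might[OF derives.Ax]]) (use Cons.prems in simp_all)
  moreover have "{\<nabla> (guarded ds \<chi>)} \<turnstile> Or (\<nabla> (Neg d)) (\<nabla> (guarded ds \<chi>))"
    by (rule derives.OrI2[OF derives.Ax]) (use Cons.prems in simp_all)
  ultimately have "\<Gamma> \<turnstile> Or (\<nabla> (Neg d)) (\<nabla> (guarded ds \<chi>))"
    by (rule or_elim)
  then have "\<Gamma> \<turnstile> \<nabla> (guarded ds \<chi>)"
    by (rule guard_elim) (use Cons.prems in auto)
  then show ?case using Cons by simp
qed simp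

lemma finite_side_formulas:
  assumes "\<Delta> \<union> {\<phi>} \<turnstile> \<chi>"
  obtains ds where "set ds \<subseteq> \<Delta>" "insert \<phi> (set ds) \<turnstile> \<chi>"
  using fin_discharge[OF finite_support[OF assms]] finite_list by metis

text \<open>A derivation of an assumption cannot simply be substituted: if the assumption is a side formula
  of a rule that admits only classical ones, the substituted derivation may bring in nonclassical
  assumptions. In that case the side formulas are moved into a guard, the rule is applied without
  side formulas, and the guard is discharged from the new assumptions.\<close>

theorem cut:
  "\<Gamma> \<turnstile> \<chi> \<Longrightarrow> \<Gamma> \<subseteq> language \<Longrightarrow> \<Gamma>' \<subseteq> language \<Longrightarrow> \<forall>\<gamma>\<in>\<Gamma>. \<Gamma>' \<turnstile> \<gamma> \<Longrightarrow> \<Gamma>' \<turnstile> \<chi>"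
proof (induction arbitrary: \<Gamma>' rule: derives.induct)
  case (NegI \<Delta> \<Gamma> \<alpha>)
  obtain ds where ds: "set ds \<subseteq> \<Delta>" "insert \<alpha> (set ds) \<turnstile> Bot"
    by (rule finite_side_formulas[OF NegI.hyps(4)])
  have cl: "\<forall>d\<in>set ds. classical d \<and> \<Gamma>' \<turnstile> d"
    using ds(1) NegI.hyps(1,2) NegI.prems(3) by blast
  have "set ds \<turnstile> Neg \<alpha>"
    by (rule NegI'[of "set ds"]) (use cl ds NegI.hyps(3) in simp_all)
  then have "\<Gamma>' \<union> set ds \<turnstile> Neg \<alpha>" by (rule weakening) blast
  then have "\<Gamma>' \<turnstile> guarded ds (Neg \<alpha>)"
    by (rule guardedI) (use cl NegI.hyps(3) in simp_all)
  then show ?case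
    by (rule guardedE[OF _ cl]) (use NegI.hyps(3) in simp)
next
  case (RAA \<Delta> \<Gamma> \<alpha>)
  obtain ds where ds: "set ds \<subseteq> \<Delta>" "insert (Neg \<alpha>) (set ds) \<turnstile> Bot"
    by (rule finite_side_formulas[OF RAA.hyps(4)])
  have cl: "\<forall>d\<in>set ds. classical d \<and> \<Gamma>' \<turnstile> d"
    using ds(1) RAA.hyps(1,2) RAA.prems(3) by blast
  have "set ds \<turnstile> \<alpha>"
    by (rule RAA'[of "set ds"]) (use cl ds RAA.hyps(3) in simp_all)
  then have "\<Gamma>' \<union> set ds \<turnstile> \<alpha>" by (rule weakening) blast
  then have "\<Gamma>' \<turnstile> guarded ds \<alpha>"
    by (rule guardedI) (use cl RAA.hyps(3) in \<open>simp_all add: classical_in_ML\<close>)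
  then show ?case
    by (rule guardedE[OF _ cl]) (use RAA.hyps(3) in \<open>simp add: classical_in_ML\<close>)
next
  case (OrE \<Delta> \<Gamma> \<phi> \<psi> \<chi>)
  obtain ds1 where 1: "set ds1 \<subseteq> \<Delta>" "insert \<phi> (set ds1) \<turnstile> \<chi>"
    by (rule finite_side_formulas[OF OrE.hyps(4)])
  obtain ds2 where 2: "set ds2 \<subseteq> \<Delta>" "insert \<psi> (set ds2) \<turnstile> \<chi>"
    by (rule finite_side_formulas[OF OrE.hyps(5)])
  let ?ds = "ds1 @ ds2"
  have cl: "\<forall>d\<in>set ?ds. classical d \<and> \<Gamma>' \<turnstile> d"
    using 1(1) 2(1) OrE.hyps(1,2) OrE.prems(3) by auto
  have "\<Gamma> \<turnstile> \<chi>" using OrE.hyps by (rule derives.OrE)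
  then have L: "in_ML b \<chi>" using OrE.prems(1) by (rule language_closed)
  have "{\<phi>} \<union> set ?ds \<turnstile> \<chi>" using 1(2) by (rule weakening) auto
  then have g1: "{\<phi>} \<turnstile> guarded ?ds \<chi>" by (rule guardedI) (use cl L in simp_all)
  have "{\<psi>} \<union> set ?ds \<turnstile> \<chi>" using 2(2) by (rule weakening) auto
  then have g2: "{\<psi>} \<turnstile> guarded ?ds \<chi>" by (rule guardedI) (use cl L in simp_all)
  have "\<Gamma>' \<turnstile> guarded ?ds \<chi>"
    by (rule or_elim[OF OrE.IH(1)[OF OrE.prems] g1 g2])
  then show ?case by (rule guardedE[OF _ cl L])
next
  case (BulMon \<Delta> \<Gamma> \<phi> \<psi>)
  obtain ds where 1: "set ds \<subseteq> \<Delta>" "insert \<phi> (set ds) \<turnstile> \<psi>"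
    by (rule finite_side_formulas[OF BulMon.hyps(4)])
  have cl: "\<forall>d\<in>set ds. classical d \<and> \<Gamma>' \<turnstile> d"
    using 1(1) BulMon.hyps(1,2) BulMon.prems(3) by blast
  have "\<Gamma> \<turnstile> \<nabla> \<psi>" using BulMon.hyps by (rule derives.BulMon)
  from language_closed[OF this BulMon.prems(1)] have L: "in_ML b \<psi>" by simp
  have "{\<phi>} \<turnstile> guarded ds \<psi>"
    by (rule guardedI) (use L cl 1(2) in simp_all)
  then have "\<Gamma>' \<turnstile> \<nabla> (guarded ds \<psi>)"
    by (rule might_mono[OF BulMon.IH(1)[OF BulMon.prems]])
  then show ?case by (rule might_guardedE[OF _ cl L])
next
  case (OrBulE \<Gamma> \<phi> \<psi> \<chi>)
  have L: "in_ML b \<phi>" "in_ML b \<psi>"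
    using language_closed[OF OrBulE.hyps(1) OrBulE.prems(1)] by simp_all
  have *: "insert \<theta> \<Gamma>' \<turnstile> \<chi>" if "in_ML b \<theta>"
    and IH: "\<And>\<Gamma>'. \<Gamma> \<union> {\<theta>} \<subseteq> language \<Longrightarrow> \<Gamma>' \<subseteq> language \<Longrightarrow> \<forall>\<gamma>\<in>\<Gamma> \<union> {\<theta>}. \<Gamma>' \<turnstile> \<gamma> \<Longrightarrow> \<Gamma>' \<turnstile> \<chi>" for \<theta>
  proof (rule IH)
    show "\<forall>\<gamma>\<in>\<Gamma> \<union> {\<theta>}. insert \<theta> \<Gamma>' \<turnstile> \<gamma>"
      using OrBulE.prems(3) weakening[of \<Gamma>' _ "insert \<theta> \<Gamma>'"] by (auto intro: derives.Ax)
  qed (use OrBulE.prems that in auto)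
  show ?case
    by (rule OrBulE'[OF OrBulE.IH(1)[OF OrBulE.prems]]; rule *)
      (use L in simp, erule (2) OrBulE.IH(2), use L in simp, erule (2) OrBulE.IH(3))
next
  case (BoxOrBulE \<Gamma> \<phi> \<psi> \<chi>)
  have L: "in_ML b \<phi>" "in_ML b \<psi>"
    using language_closed[OF BoxOrBulE.hyps(1) BoxOrBulE.prems(1)] by simp_all
  have *: "insert \<theta> \<Gamma>' \<turnstile> \<chi>" if "in_ML b \<theta>"
    and IH: "\<And>\<Gamma>'. \<Gamma> \<union> {\<theta>} \<subseteq> language \<Longrightarrow> \<Gamma>' \<subseteq> language \<Longrightarrow> \<forall>\<gamma>\<in>\<Gamma> \<union> {\<theta>}. \<Gamma>' \<turnstile> \<gamma> \<Longrightarrow> \<Gamma>' \<turnstile> \<chi>" for \<theta>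
  proof (rule IH)
    show "\<forall>\<gamma>\<in>\<Gamma> \<union> {\<theta>}. insert \<theta> \<Gamma>' \<turnstile> \<gamma>"
      using BoxOrBulE.prems(3) weakening[of \<Gamma>' _ "insert \<theta> \<Gamma>'"] by (auto intro: derives.Ax)
  qed (use BoxOrBulE.prems that in auto)
  show ?case
    by (rule BoxOrBulE'[OF BoxOrBulE.IH(1)[OF BoxOrBulE.prems]]; rule *)
      (use L in simp, erule (2) BoxOrBulE.IH(2), use L in simp, erule (2) BoxOrBulE.IH(3))
next
  case (BoxMon \<phi>s \<psi> \<Gamma>)
  show ?case by (rule derives.BoxMon[OF BoxMon.hyps(1)]) (use BoxMon.IH(2) BoxMon.prems in blast)
next
  case (NegE \<alpha> \<Gamma> \<phi>) show ?case by (rule derives.NegE[of \<alpha>]) (use NegE in blast)+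
next
  case (AndE1 \<Gamma> \<phi> \<psi>) show ?case by (rule derives.AndE1[of _ _ \<phi> \<psi>]) (use AndE1 in blast)+
next
  case (AndE2 \<Gamma> \<phi> \<psi>) show ?case by (rule derives.AndE2[of _ _ \<phi> \<psi>]) (use AndE2 in blast)+
next
  case (DiaMon \<phi> \<psi> \<Gamma>) show ?case by (rule derives.DiaMon[of _ \<phi>]) (use DiaMon in blast)+
next
  case (BoxDiaBulExc \<Gamma> \<psi> \<phi>)
  show ?case by (rule derives.BoxDiaBulExc[of _ _ \<psi>]) (use BoxDiaBulExc in blast)+
next
  case (BulNegE \<alpha> \<Gamma> \<phi>) show ?case by (rule derives.BulNegE[of \<alpha>]) (use BulNegE in blast)+
next
  case Ax then show ?case by blast
next
  case OrI1 show ?case by (rule derives.OrI1) (use OrI1 in blast)+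
next
  case OrI2 show ?case by (rule derives.OrI2) (use OrI2 in blast)+
next
  case AndI show ?case by (rule derives.AndI) (use AndI in blast)+
next
  case DiaBoxInter show ?case by (rule derives.DiaBoxInter) (use DiaBoxInter in blast)+
next
  case BoxDiaInter show ?case by (rule derives.BoxDiaInter) (use BoxDiaInter in blast)+
next
  case DiaOrDistr show ?case by (rule derives.DiaOrDistr) (use DiaOrDistr in blast)+
next
  case MightJoin show ?case by (rule derives.MightJoin) (use MightJoin in blast)+
next
  case MightE show ?case by (rule derives.MightE) (use MightE in blast)+
next
  case SingMightAndSimpl
  show ?case by (rule derives.SingMightAndSimpl) (use SingMightAndSimpl in blast)+
next
  case BulOrDistr show ?case by (rule derives.BulOrDistr) (use BulOrDistr in blast)+
next
  case BulI show ?case by (rule derives.BulI) (use BulI in blast)+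
next
  case BulDistr show ?case by (rule derives.BulDistr) (use BulDistr in blast)+
next
  case DiaBoxBulExc show ?case by (rule derives.DiaBoxBulExc) (use DiaBoxBulExc in blast)+
next
  case DiaBulDistr show ?case by (rule derives.DiaBulDistr) (use DiaBulDistr in blast)+
next
  case BulDiaDistr show ?case by (rule derives.BulDiaDistr) (use BulDiaDistr in blast)+
qed

lemma cut_insert:
  assumes "insert \<phi> \<Gamma> \<turnstile> \<chi>" "\<Gamma> \<turnstile> \<phi>" "\<Gamma> \<subseteq> language"
  shows "\<Gamma> \<turnstile> \<chi>"
proof (rule cut[OF assms(1)])
  show "\<forall>\<gamma>\<in>insert \<phi> \<Gamma>. \<Gamma> \<turnstile> \<gamma>" using assms(2) by (auto intro: derives.Ax)
qed (use assms language_closed in auto)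

end

section \<open>Clauses and the case analysis behind a split disjunction\<close>

text \<open>The clause \<open>(\<alpha>, \<beta>s)\<close> stands for the conjunction of \<open>\<alpha>\<close> with all \<open>\<nabla>\<beta>\<close> for \<open>\<beta>\<close> in \<open>\<beta>s\<close>; it is a
  list so that the conjunction can be formed as a formula.\<close>

type_synonym 'p clause = "'p fm \<times> 'p fm list"

definition classical_clause :: "'p clause \<Rightarrow> bool"
  where "classical_clause c \<longleftrightarrow> classical (fst c) \<and> (\<forall>\<beta>\<in>set (snd c). classical \<beta>)"

text \<open>If a team splits into nonempty parts, one for each clause of \<open>K\<close>, then each of its worlds
  satisfies the first entry of some clause, and each requirement \<open>\<beta>\<close> of a clause is met at a world
  that also satisfies the first entry of this clause. The merged clause says just this.
  Conversely it suffices for a split into parts, some perhaps empty, that satisfy their clauses: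
  take as part of a clause all worlds that satisfy its first entry.\<close>

definition merge :: "'p clause list \<Rightarrow> 'p clause"
  where "merge K = (Ors Bot (map fst K), concat (map (\<lambda>c. map (And (fst c)) (snd c)) K))"

lemma fst_merge: "fst (merge K) = Ors Bot (map fst K)"
  by (simp add: merge_def)

lemma set_snd_merge: "set (snd (merge K)) = (\<Union>c\<in>set K. And (fst c) ` set (snd c))"
  by (simp add: merge_def)

lemma classical_clause_merge: "\<forall>c\<in>set K. classical_clause c \<Longrightarrow> classical_clause (merge K)"
  by (auto simp: classical_clause_def fst_merge set_snd_merge)

context might_logic
begin

definition clause_set :: "'p clause \<Rightarrow> 'p fm set"
  where "clause_set c = insert (fst c) ((\<lambda>\<beta>. \<nabla> \<beta>) ` set (snd c))"

definition clause_fm :: "'p clause \<Rightarrow> 'p fm"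
  where "clause_fm c = Ands (fst c) (map (\<lambda>\<beta>. \<nabla> \<beta>) (snd c))"

definition disj :: "'p clause list \<Rightarrow> 'p fm"
  where "disj K = foldr (\<lambda>c. Or (clause_fm c)) K Bot"

lemma disj_simps [simp]: "disj [] = Bot" "disj (c # K) = Or (clause_fm c) (disj K)"
  by (simp_all add: disj_def)

lemma clause_in_language:
  assumes "classical_clause c" shows "clause_set c \<subseteq> language" "in_ML b (clause_fm c)"
  using assms by (auto simp: classical_clause_def clause_set_def clause_fm_def classical_in_ML)

lemma disj_in_language: "\<forall>c\<in>set K. classical_clause c \<Longrightarrow> in_ML b (disj K)"
  by (induction K) (simp_all add: clause_in_language)

lemma Ands_iff: "\<Gamma> \<turnstile> Ands \<phi> \<chi>s \<longleftrightarrow> \<Gamma> \<turnstile> \<phi> \<and> (\<forall>\<chi>\<in>set \<chi>s. \<Gamma> \<turnstile> \<chi>)"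
proof (induction \<chi>s rule: rev_induct)
  case (snoc \<chi> \<chi>s)
  have "\<Gamma> \<turnstile> And (Ands \<phi> \<chi>s) \<chi> \<longleftrightarrow> \<Gamma> \<turnstile> Ands \<phi> \<chi>s \<and> \<Gamma> \<turnstile> \<chi>"
    using derives.AndI derives.AndE1 derives.AndE2 by metis
  with snoc show ?case by auto
qed simp

lemma Ors_elim:
  "\<Gamma> \<turnstile> Ors \<phi> \<chi>s \<Longrightarrow> {\<phi>} \<turnstile> \<psi> \<Longrightarrow> \<forall>\<chi>\<in>set \<chi>s. {\<chi>} \<turnstile> \<psi> \<Longrightarrow> in_ML b \<phi> \<Longrightarrow> \<Gamma> \<turnstile> \<psi>"
proof (induction \<chi>s arbitrary: \<Gamma> rule: rev_induct)
  case Nil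
  then show ?case using cut_single[of \<Gamma> \<phi> \<psi>] by simp
next
  case (snoc \<chi> \<chi>s)
  have "{Ors \<phi> \<chi>s} \<turnstile> \<psi>"
    by (rule snoc.IH) (use snoc.prems in \<open>simp_all add: derives.Ax\<close>)
  with snoc.prems show ?case by (simp add: or_elim[of \<Gamma> "Ors \<phi> \<chi>s" \<chi>])
qed

text \<open>The set of its conjuncts is the convenient form of a clause on the left of \<open>\<turnstile>\<close>; the single
  formula is required below a connective.\<close>

lemma clause_fm_iff: "\<Gamma> \<turnstile> clause_fm c \<longleftrightarrow> (\<forall>\<gamma>\<in>clause_set c. \<Gamma> \<turnstile> \<gamma>)"
  by (auto simp: clause_fm_def clause_set_def Ands_iff)

lemma clause_cut:
  assumes "\<forall>\<gamma>\<in>clause_set c. \<Gamma> \<turnstile> \<gamma>" "clause_set c \<turnstile> \<phi>" "classical_clause c" "\<Gamma> \<subseteq> language"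
  shows "\<Gamma> \<turnstile> \<phi>"
  using cut[OF assms(2) clause_in_language(1)[OF assms(3)] assms(4,1)] .

lemma clause_fm_entails:
  assumes "clause_set c \<turnstile> \<phi>" "classical_clause c" shows "{clause_fm c} \<turnstile> \<phi>"
proof (rule clause_cut[OF _ assms])
  show "\<forall>\<gamma>\<in>clause_set c. {clause_fm c} \<turnstile> \<gamma>"
    using clause_fm_iff[of "{clause_fm c}" c] by (simp add: derives.Ax)
qed (use clause_in_language(2)[OF assms(2)] in simp)

lemma disj_elim:
  "\<Gamma> \<turnstile> disj K \<Longrightarrow> \<forall>c\<in>set K. {clause_fm c} \<turnstile> \<chi> \<Longrightarrow> in_ML b \<chi> \<Longrightarrow> \<Gamma> \<turnstile> \<chi>"
proof (induction K arbitrary: \<Gamma>)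
  case Nil then show ?case by (simp add: explode)
next
  case (Cons c K)
  have "{disj K} \<turnstile> \<chi>" by (rule Cons.IH) (use Cons.prems in \<open>simp_all add: derives.Ax\<close>)
  with Cons.prems show ?case by (simp add: or_elim[of \<Gamma> "clause_fm c" "disj K"])
qed

lemma disj_intro:
  "c \<in> set K \<Longrightarrow> \<Gamma> \<turnstile> clause_fm c \<Longrightarrow> \<forall>c\<in>set K. classical_clause c \<Longrightarrow> \<Gamma> \<turnstile> disj K"
proof (induction K)
  case (Cons d K)
  show ?case
  proof (cases "c = d")
    case True
    with Cons.prems show ?thesis by (simp add: derives.OrI1 disj_in_language)
  next
    case False
    with Cons have "\<Gamma> \<turnstile> disj K" by simp
    with Cons.prems show ?thesis by (simp add: derives.OrI2 clause_in_language)
  qed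
qed simp

lemma clause_set_might:
  assumes "classical_clause c" "\<beta> \<in> set (snd c)"
  shows "clause_set c \<turnstile> \<nabla> (And (fst c) \<beta>)"
proof (rule BulMon'[of "{fst c}" _ \<beta>])
  show "clause_set c \<turnstile> \<nabla> \<beta>" using assms by (simp add: derives.Ax clause_set_def)
  show "insert \<beta> {fst c} \<turnstile> And (fst c) \<beta>" by (rule derives.AndI) (simp_all add: derives.Ax)
qed (use assms in \<open>simp_all add: classical_clause_def clause_set_def\<close>)

text \<open>The shape in which the distribution rules for \<open>\<nabla>\<close> deliver the clause \<open>(\<alpha>, \<beta>s)\<close> when they are
  applied to the formulas \<open>\<nabla>(\<alpha> \<and> \<beta>)\<close>; the extra disjuncts \<open>\<alpha> \<and> \<beta>\<close> are absorbed by \<open>\<alpha>\<close>.\<close>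

abbreviation distributed :: "'p clause \<Rightarrow> 'p fm"
  where "distributed c \<equiv> Ands (Ors (fst c) (map (And (fst c)) (snd c)))
    (map (\<lambda>\<chi>. \<nabla> \<chi>) (map (And (fst c)) (snd c)))"

lemma distributed_entails:
  assumes "in_ML b (fst c)" shows "{distributed c} \<turnstile> clause_fm c"
proof -
  let ?\<chi>s = "map (And (fst c)) (snd c)" and ?D = "distributed c"
  have D: "{?D} \<turnstile> Ors (fst c) ?\<chi>s" "\<forall>\<chi>\<in>set ?\<chi>s. {?D} \<turnstile> \<nabla> \<chi>"
    using Ands_iff[of "{?D}" "Ors (fst c) ?\<chi>s" "map (\<lambda>\<chi>. \<nabla> \<chi>) ?\<chi>s"] by (simp_all add: derives.Ax)
  have d1: "{And (fst c) \<beta>} \<turnstile> fst c" "{And (fst c) \<beta>} \<turnstile> \<beta>" for \<beta>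
    by (rule derives.AndE1[OF derives.Ax] derives.AndE2[OF derives.Ax]; simp)+
  have "{?D} \<turnstile> fst c"
    by (rule Ors_elim[OF D(1)]) (use d1 assms in \<open>auto intro: derives.Ax\<close>)
  moreover have "{?D} \<turnstile> \<nabla> \<beta>" if "\<beta> \<in> set (snd c)" for \<beta>
    by (rule might_mono[OF _ d1(2)]) (use D(2) that in simp)
  ultimately show ?thesis
    by (simp add: clause_fm_def Ands_iff)
qed

text \<open>The distribution rule for \<open>\<nabla>\<close> repairs one disjunct at a time: it turns the first entry of a
  clause into the whole clause. The clauses already restored are collected in \<open>\<tau>\<close>. They cannot be
  replaced by \<open>\<phi>\<close> at once for each clause separately, as disjunction elimination would discard the
  \<open>\<nabla>\<close> formulas needed for the remaining ones.\<close>

lemma merge_elim: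
  assumes "\<Gamma> \<turnstile> Or (Ors Bot (map fst K)) \<tau>"
    and "\<forall>c\<in>set K. \<forall>\<beta>\<in>set (snd c). \<Gamma> \<turnstile> \<nabla> (And (fst c) \<beta>)"
    and "\<forall>c\<in>set K. classical_clause c" "\<forall>c\<in>set K. {clause_fm c} \<turnstile> \<phi>"
    and "{\<tau>} \<turnstile> \<phi>" "in_ML b \<phi>" "in_ML b \<tau>"
  shows "\<Gamma> \<turnstile> \<phi>"
  using assms
proof (induction K arbitrary: \<tau> rule: rev_induct)
  case Nil
  have "{Bot} \<turnstile> \<phi>" by (rule explode) (use Nil in \<open>simp_all add: derives.Ax\<close>)
  with Nil.prems show ?case by (simp add: or_elim[of \<Gamma> Bot \<tau>])
next
  case (snoc c K)
  let ?A = "Ors Bot (map fst K)" and ?\<chi>s = "map (And (fst c)) (snd c)"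
  let ?D = "distributed c"
  have cl: "classical_clause c" "in_ML b (fst c)" "in_ML b ?A" "in_ML b (clause_fm c)"
    using snoc.prems(3) by (auto simp: classical_clause_def classical_in_ML clause_in_language)
  have 1: "\<Gamma> \<turnstile> Or (Or ?A (fst c)) \<tau>" using snoc.prems(1) by simp
  have a1: "{?A} \<turnstile> Or (fst c) (Or ?A \<tau>)"
    by (rule derives.OrI2[OF derives.OrI1[OF derives.Ax]]) (use cl snoc.prems in simp_all)
  have a2: "{fst c} \<turnstile> Or (fst c) (Or ?A \<tau>)"
    by (rule derives.OrI1[OF derives.Ax]) (use cl snoc.prems in simp_all)
  have a3: "{\<tau>} \<turnstile> Or (fst c) (Or ?A \<tau>)"
    by (rule derives.OrI2[OF derives.OrI2[OF derives.Ax]]) (use cl snoc.prems in simp_all)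
  have a4: "{Or ?A (fst c)} \<turnstile> Or (fst c) (Or ?A \<tau>)"
    by (rule or_elim[OF derives.Ax a1 a2]) simp
  have "\<Gamma> \<turnstile> Or (fst c) (Or ?A \<tau>)" by (rule or_elim[OF 1 a4 a3])
  then have 2: "\<Gamma> \<turnstile> Or ?D (Or ?A \<tau>)"
    by (rule derives.BulDistr) (use snoc.prems(2) in auto)
  have "{?D} \<turnstile> clause_fm c" by (rule distributed_entails[OF cl(2)])
  then have "{?D} \<turnstile> Or (clause_fm c) \<tau>"
    by (rule derives.OrI1) (use snoc.prems in simp)
  then have b1: "{?D} \<turnstile> Or ?A (Or (clause_fm c) \<tau>)"
    by (rule derives.OrI2) (use cl in simp)
  have b2: "{?A} \<turnstile> Or ?A (Or (clause_fm c) \<tau>)"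
    by (rule derives.OrI1[OF derives.Ax]) (use cl snoc.prems in simp_all)
  have b3: "{\<tau>} \<turnstile> Or ?A (Or (clause_fm c) \<tau>)"
    by (rule derives.OrI2[OF derives.OrI2[OF derives.Ax]]) (use cl snoc.prems in simp_all)
  have b4: "{Or ?A \<tau>} \<turnstile> Or ?A (Or (clause_fm c) \<tau>)"
    by (rule or_elim[OF derives.Ax b2 b3]) simp
  have 3: "\<Gamma> \<turnstile> Or ?A (Or (clause_fm c) \<tau>)" by (rule or_elim[OF 2 b1 b4])
  have 4: "{Or (clause_fm c) \<tau>} \<turnstile> \<phi>"
    by (rule or_elim[OF derives.Ax[OF singletonI] _ snoc.prems(5)]) (use snoc.prems(4) in simp)
  show ?case
    by (rule snoc.IH[OF 3 _ _ _ 4]) (use cl snoc.prems in simp_all)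
qed

lemma merge_entails:
  assumes "\<forall>c\<in>set K. classical_clause c" "\<forall>c\<in>set K. clause_set c \<turnstile> \<phi>" "in_ML b \<phi>"
  shows "clause_set (merge K) \<turnstile> \<phi>"
proof (rule merge_elim)
  show "clause_set (merge K) \<turnstile> Or (Ors Bot (map fst K)) Bot"
    by (rule derives.OrI1[OF derives.Ax]) (simp_all add: clause_set_def fst_merge)
  show "\<forall>c\<in>set K. \<forall>\<beta>\<in>set (snd c). clause_set (merge K) \<turnstile> \<nabla> (And (fst c) \<beta>)"
    by (auto intro!: derives.Ax simp: clause_set_def set_snd_merge)
  show "\<forall>c\<in>set K. {clause_fm c} \<turnstile> \<phi>" using assms clause_fm_entails by blast
  show "{Bot} \<turnstile> \<phi>" by (rule explode) (use assms in \<open>simp_all add: derives.Ax\<close>)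
qed (use assms in simp_all)

text \<open>The Boolean case distinction hidden in a split disjunction of clauses. For each clause, in turn,
  either one of its requirements holds nowhere and the disjunct can be dropped, or all requirements
  become assumptions and only the first entry has to be kept as disjunct; these entries accumulate
  in \<open>\<sigma>\<close>. The sublist \<open>K'\<close> contains the clauses that survive. Both the rule for \<open>\<nabla>\<phi> \<or> \<psi>\<close> and the
  one for \<open>\<box>(\<nabla>\<phi> \<or> \<psi>)\<close> have this effect: \<open>F\<close> and \<open>G\<close> are the identity for the former, and \<open>F = \<box>\<close>,
  \<open>G = \<diamond>\<close> for the latter.\<close>

lemma split_cases:
  fixes F G :: "'p fm \<Rightarrow> 'p fm"
  assumes mono: "\<And>\<Gamma> \<phi> \<psi>. \<Gamma> \<subseteq> language \<Longrightarrow> \<Gamma> \<turnstile> F \<phi> \<Longrightarrow> {\<phi>} \<turnstile> \<psi> \<Longrightarrow> in_ML b \<phi> \<Longrightarrow> \<Gamma> \<turnstile> F \<psi>"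
    and F_case: "\<And>\<Gamma> \<phi> \<psi> \<chi>. \<Gamma> \<turnstile> F (Or (\<nabla> \<phi>) \<psi>) \<Longrightarrow> insert (\<nabla> (G \<phi>)) \<Gamma> \<turnstile> \<chi> \<Longrightarrow>
        insert (F \<psi>) \<Gamma> \<turnstile> \<chi> \<Longrightarrow> \<Gamma> \<turnstile> \<chi>"
    and FG: "\<And>\<phi>. in_ML b (F \<phi>) = in_ML b \<phi>" "\<And>\<phi>. in_ML b (G \<phi>) = in_ML b \<phi>"
  shows "\<Gamma> \<subseteq> language \<Longrightarrow> \<forall>c\<in>set K. classical_clause c \<Longrightarrow> classical \<sigma> \<Longrightarrow> \<Gamma> \<turnstile> F (Or \<sigma> (disj K)) \<Longrightarrow>
    \<forall>K'\<in>set (subseqs K). insert (F (Ors \<sigma> (map fst K')))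
        (\<Gamma> \<union> (\<lambda>\<beta>. \<nabla> (G \<beta>)) ` set (snd (merge K'))) \<turnstile> \<chi> \<Longrightarrow> \<Gamma> \<turnstile> \<chi>"
proof (induction K arbitrary: \<sigma> \<Gamma>)
  case Nil
  have "{Bot} \<turnstile> \<sigma>" "{\<sigma>} \<turnstile> \<sigma>"
    by (rule explode, simp_all add: derives.Ax classical_in_ML Nil)
  then have "{Or \<sigma> Bot} \<turnstile> \<sigma>"
    by - (rule or_elim[OF derives.Ax[OF singletonI]])
  then have "\<Gamma> \<turnstile> F \<sigma>"
    by (rule mono[OF Nil.prems(1), rotated]) (use Nil in \<open>simp_all add: classical_in_ML\<close>)
  moreover have "insert (F \<sigma>) \<Gamma> \<turnstile> \<chi>" using Nil.prems(5) by (simp add: merge_def)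
  ultimately show ?case using cut_insert Nil.prems(1) by blast
next
  case (Cons c K)
  let ?R = "disj K" and ?\<alpha> = "fst c"
  let ?X = "Or \<sigma> (Or (clause_fm c) ?R)"
  have cl: "classical_clause c" "in_ML b \<sigma>" "in_ML b ?\<alpha>" "in_ML b ?R" "in_ML b (clause_fm c)"
      "\<forall>\<beta>\<in>set (snd c). in_ML b \<beta>"
    using Cons.prems(2,3)
    by (simp_all add: classical_in_ML clause_in_language disj_in_language classical_clause_def)
  have XI: "{?X} \<turnstile> \<theta>" if "{\<sigma>} \<turnstile> \<theta>" "{clause_fm c} \<turnstile> \<theta>" "{?R} \<turnstile> \<theta>" for \<theta>
  proof -
    have "{Or (clause_fm c) ?R} \<turnstile> \<theta>"
      by (rule or_elim[OF derives.Ax that(2,3)]) simp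
    then show ?thesis by (rule or_elim[OF derives.Ax[OF singletonI] that(1)])
  qed
  let ?D = "\<lambda>bs. (\<lambda>\<beta>. \<nabla> (G (And ?\<alpha> \<beta>))) ` set bs"
  have inner: "set bs \<subseteq> set (snd c) \<Longrightarrow> \<Gamma> \<subseteq> language \<Longrightarrow> \<Gamma> \<turnstile> F ?X \<Longrightarrow> \<Gamma> \<union> ?D bs \<turnstile> \<chi> \<Longrightarrow>
      insert (F (Or \<sigma> ?R)) \<Gamma> \<turnstile> \<chi> \<Longrightarrow> \<Gamma> \<turnstile> \<chi>" for bs \<Gamma>
  proof (induction bs arbitrary: \<Gamma>)
    case (Cons \<beta> bs)
    let ?\<gamma> = "\<nabla> (G (And ?\<alpha> \<beta>))"
    let ?Y = "Or (\<nabla> (And ?\<alpha> \<beta>)) (Or \<sigma> ?R)"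
    have \<beta>: "\<beta> \<in> set (snd c)" "in_ML b \<beta>" using Cons.prems(1) cl by simp_all
    have "{?X} \<turnstile> ?Y"
    proof (rule XI)
      show "{\<sigma>} \<turnstile> ?Y"
        by (rule derives.OrI2[OF derives.OrI1[OF derives.Ax]]) (use cl \<beta> in simp_all)
      show "{?R} \<turnstile> ?Y"
        by (rule derives.OrI2[OF derives.OrI2[OF derives.Ax]]) (use cl \<beta> in simp_all)
      show "{clause_fm c} \<turnstile> ?Y"
        by (rule derives.OrI1[OF clause_fm_entails[OF clause_set_might]]) (use cl \<beta> in simp_all)
    qed
    then have "\<Gamma> \<turnstile> F ?Y"
      by (rule mono[OF Cons.prems(2,3)]) (use cl in simp)
    then show ?case
    proof (rule F_case)
      show "insert ?\<gamma> \<Gamma> \<turnstile> \<chi>"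
      proof (rule Cons.IH)
        show "insert ?\<gamma> \<Gamma> \<subseteq> language" using Cons.prems(2) cl \<beta> FG by simp
        show "insert ?\<gamma> \<Gamma> \<turnstile> F ?X" using Cons.prems(3) by (rule weakening) blast
        show "insert ?\<gamma> \<Gamma> \<union> ?D bs \<turnstile> \<chi>" using Cons.prems(4) by simp
        show "insert (F (Or \<sigma> ?R)) (insert ?\<gamma> \<Gamma>) \<turnstile> \<chi>"
          using Cons.prems(5) by (rule weakening) blast
      qed (use Cons.prems(1) in simp)
      show "insert (F (Or \<sigma> ?R)) \<Gamma> \<turnstile> \<chi>" by (rule Cons.prems(5))
    qed
  qed simp
  have FX: "\<Gamma> \<turnstile> F ?X" using Cons.prems(4) by simp
  show ?case
  proof (rule inner[OF order.refl Cons.prems(1) FX])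
    show "insert (F (Or \<sigma> ?R)) \<Gamma> \<turnstile> \<chi>"
    proof (rule Cons.IH)
      show "\<forall>K'\<in>set (subseqs K). insert (F (Ors \<sigma> (map fst K')))
          (insert (F (Or \<sigma> ?R)) \<Gamma> \<union> (\<lambda>\<beta>. \<nabla> (G \<beta>)) ` set (snd (merge K'))) \<turnstile> \<chi>"
      proof
        fix K' assume "K' \<in> set (subseqs K)"
        then have "insert (F (Ors \<sigma> (map fst K'))) (\<Gamma> \<union> (\<lambda>\<beta>. \<nabla> (G \<beta>)) ` set (snd (merge K'))) \<turnstile> \<chi>"
          using Cons.prems(5) by (auto simp: Let_def)
        then show "insert (F (Ors \<sigma> (map fst K')))
          (insert (F (Or \<sigma> ?R)) \<Gamma> \<union> (\<lambda>\<beta>. \<nabla> (G \<beta>)) ` set (snd (merge K'))) \<turnstile> \<chi>"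
          by (rule weakening) blast
      qed
      show "insert (F (Or \<sigma> ?R)) \<Gamma> \<turnstile> F (Or \<sigma> ?R)" by (rule derives.Ax) simp
    qed (use Cons.prems(1-3) cl FG in simp_all)
    show "\<Gamma> \<union> ?D (snd c) \<turnstile> \<chi>"
    proof (rule Cons.IH)
      show "\<forall>K'\<in>set (subseqs K). insert (F (Ors (Or \<sigma> ?\<alpha>) (map fst K')))
          ((\<Gamma> \<union> ?D (snd c)) \<union> (\<lambda>\<beta>. \<nabla> (G \<beta>)) ` set (snd (merge K'))) \<turnstile> \<chi>"
      proof
        fix K' assume "K' \<in> set (subseqs K)"
        then have "c # K' \<in> set (subseqs (c # K))" by (simp add: Let_def)
        with Cons.prems(5) have "insert (F (Ors \<sigma> (map fst (c # K'))))
            (\<Gamma> \<union> (\<lambda>\<beta>. \<nabla> (G \<beta>)) ` set (snd (merge (c # K')))) \<turnstile> \<chi>" by (rule bspec)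
        then show "insert (F (Ors (Or \<sigma> ?\<alpha>) (map fst K')))
          ((\<Gamma> \<union> ?D (snd c)) \<union> (\<lambda>\<beta>. \<nabla> (G \<beta>)) ` set (snd (merge K'))) \<turnstile> \<chi>"
          unfolding list.map Ors_simps by (rule weakening) (auto simp: set_snd_merge)
      qed
      show "classical (Or \<sigma> ?\<alpha>)" using Cons.prems(3) cl by (simp add: classical_clause_def)
      show L: "\<Gamma> \<union> ?D (snd c) \<subseteq> language" using Cons.prems(1) cl FG by auto
      let ?Z = "Or (Or \<sigma> ?\<alpha>) ?R"
      have XZ: "{?X} \<turnstile> ?Z"
      proof (rule XI)
        show "{\<sigma>} \<turnstile> ?Z"
          by (rule derives.OrI1[OF derives.OrI1[OF derives.Ax]]) (use cl in simp_all)
        have "{clause_fm c} \<turnstile> ?\<alpha>"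
          by (rule clause_fm_entails[OF derives.Ax]) (use cl in \<open>simp_all add: clause_set_def\<close>)
        then have "{clause_fm c} \<turnstile> Or \<sigma> ?\<alpha>"
          by (rule derives.OrI2) (use cl in simp)
        then show "{clause_fm c} \<turnstile> ?Z"
          by (rule derives.OrI1) (use cl in simp)
        show "{?R} \<turnstile> ?Z"
          by (rule derives.OrI2[OF derives.Ax]) (use cl in simp_all)
      qed
      have "\<Gamma> \<union> ?D (snd c) \<turnstile> F ?X" using FX by (rule weakening) blast
      from mono[OF L this XZ] show "\<Gamma> \<union> ?D (snd c) \<turnstile> F ?Z"
        using cl by simp
    qed (use Cons.prems(2) in simp)
  qed
qed

end

section \<open>Derivable normal forms\<close>

context might_logic
begin

text \<open>\<open>\<phi>\<close> is interderivable with the Boolean disjunction of the clauses \<open>L\<close>: the second conjunct is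
  its introduction rule, the third its elimination rule. The elimination rule with arbitrary \<open>\<Gamma>\<close>
  is what distinguishes Boolean from split disjunction.\<close>

definition derives_normal :: "'p fm \<Rightarrow> 'p clause list \<Rightarrow> bool"
  where "derives_normal \<phi> L \<longleftrightarrow>
    (\<forall>c\<in>set L. classical_clause c) \<and> (\<forall>c\<in>set L. clause_set c \<turnstile> \<phi>) \<and>
    (\<forall>\<Gamma> \<chi>. \<Gamma> \<subseteq> language \<longrightarrow> in_ML b \<chi> \<longrightarrow> \<Gamma> \<turnstile> \<phi> \<longrightarrow> (\<forall>c\<in>set L. \<Gamma> \<union> clause_set c \<turnstile> \<chi>) \<longrightarrow> \<Gamma> \<turnstile> \<chi>)"

lemma derives_normalI:
  assumes "\<And>c. c \<in> set L \<Longrightarrow> classical_clause c" "\<And>c. c \<in> set L \<Longrightarrow> clause_set c \<turnstile> \<phi>"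
    and "\<And>\<Gamma> \<chi>. \<Gamma> \<subseteq> language \<Longrightarrow> in_ML b \<chi> \<Longrightarrow> \<Gamma> \<turnstile> \<phi> \<Longrightarrow> \<forall>c\<in>set L. \<Gamma> \<union> clause_set c \<turnstile> \<chi> \<Longrightarrow> \<Gamma> \<turnstile> \<chi>"
  shows "derives_normal \<phi> L"
  using assms unfolding derives_normal_def by blast

lemma derives_normalD:
  assumes "derives_normal \<phi> L"
  shows "\<forall>c\<in>set L. classical_clause c" "\<forall>c\<in>set L. clause_set c \<turnstile> \<phi>"
    and "\<Gamma> \<subseteq> language \<Longrightarrow> in_ML b \<chi> \<Longrightarrow> \<Gamma> \<turnstile> \<phi> \<Longrightarrow> \<forall>c\<in>set L. \<Gamma> \<union> clause_set c \<turnstile> \<chi> \<Longrightarrow> \<Gamma> \<turnstile> \<chi>"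
  using assms unfolding derives_normal_def by blast+

text \<open>A Boolean disjunction implies the split one, since the empty team satisfies every clause.\<close>

lemma entails_disj:
  assumes "derives_normal \<phi> L" "in_ML b \<phi>" shows "{\<phi>} \<turnstile> disj L"
proof (rule derives_normalD(3)[OF assms(1)])
  show "\<forall>c\<in>set L. {\<phi>} \<union> clause_set c \<turnstile> disj L"
  proof
    fix c assume c: "c \<in> set L"
    have "{\<phi>} \<union> clause_set c \<turnstile> clause_fm c" by (simp add: clause_fm_iff derives.Ax)
    then show "{\<phi>} \<union> clause_set c \<turnstile> disj L"
      by (rule disj_intro[OF c _ derives_normalD(1)[OF assms(1)]])
  qed
  show "in_ML b (disj L)" by (rule disj_in_language[OF derives_normalD(1)[OF assms(1)]])
qed (use assms in \<open>simp_all add: derives.Ax\<close>)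

lemma derives_normal_classical:
  assumes "classical \<alpha>" shows "derives_normal \<alpha> [(\<alpha>, [])]"
proof (rule derives_normalI)
  fix \<Gamma> \<chi>
  assume "\<Gamma> \<subseteq> language" "\<Gamma> \<turnstile> \<alpha>" "\<forall>c\<in>set [(\<alpha>, [])]. \<Gamma> \<union> clause_set c \<turnstile> \<chi>"
  then show "\<Gamma> \<turnstile> \<chi>" by - (rule cut_insert[of \<alpha>], simp_all add: clause_set_def)
qed (use assms in \<open>simp_all add: classical_clause_def clause_set_def derives.Ax\<close>)

lemma cut_clause:
  assumes "\<Gamma> \<union> clause_set c \<turnstile> \<chi>" "\<forall>\<gamma>\<in>clause_set c. \<Gamma>' \<turnstile> \<gamma>" "\<Gamma> \<subseteq> \<Gamma>'" "\<Gamma>' \<subseteq> language"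
    "classical_clause c"
  shows "\<Gamma>' \<turnstile> \<chi>"
proof (rule cut[OF assms(1)])
  show "\<forall>\<gamma>\<in>\<Gamma> \<union> clause_set c. \<Gamma>' \<turnstile> \<gamma>" using assms by (auto intro: derives.Ax)
qed (use assms clause_in_language[OF assms(5)] in auto)

definition and_clause :: "'p clause \<Rightarrow> 'p clause \<Rightarrow> 'p clause"
  where "and_clause c d = (And (fst c) (fst d), snd c @ snd d)"

lemma derives_normal_And:
  assumes \<phi>: "derives_normal \<phi> L" and \<psi>: "derives_normal \<psi> L'"
  shows "derives_normal (And \<phi> \<psi>) [and_clause c d. c \<leftarrow> L, d \<leftarrow> L']"
proof (rule derives_normalI)
  fix e assume "e \<in> set [and_clause c d. c \<leftarrow> L, d \<leftarrow> L']"
  then obtain c d where e: "e = and_clause c d" and c: "c \<in> set L" and d: "d \<in> set L'" by auto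
  note cl = derives_normalD(1)[OF \<phi>, rule_format, OF c] derives_normalD(1)[OF \<psi>, rule_format, OF d]
  show e_cl: "classical_clause e"
    using cl by (auto simp: e and_clause_def classical_clause_def)
  have "And (fst c) (fst d) \<in> clause_set e" by (simp add: e and_clause_def clause_set_def)
  then have "clause_set e \<turnstile> fst c" "clause_set e \<turnstile> fst d"
    by (rule derives.AndE1[OF derives.Ax] derives.AndE2[OF derives.Ax]; assumption)+
  then have *: "\<forall>\<gamma>\<in>clause_set c. clause_set e \<turnstile> \<gamma>" "\<forall>\<gamma>\<in>clause_set d. clause_set e \<turnstile> \<gamma>"
    by (auto intro!: derives.Ax simp: e and_clause_def clause_set_def)
  show "clause_set e \<turnstile> And \<phi> \<psi>"
  proof (rule derives.AndI)
    show "clause_set e \<turnstile> \<phi>"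
      by (rule clause_cut[OF *(1)])
        (use derives_normalD(2)[OF \<phi>] c cl clause_in_language(1)[OF e_cl] in auto)
    show "clause_set e \<turnstile> \<psi>"
      by (rule clause_cut[OF *(2)])
        (use derives_normalD(2)[OF \<psi>] d cl clause_in_language(1)[OF e_cl] in auto)
  qed
next
  fix \<Gamma> \<chi>
  assume L: "\<Gamma> \<subseteq> language" and \<chi>: "in_ML b \<chi>" and *: "\<Gamma> \<turnstile> And \<phi> \<psi>"
    and all: "\<forall>e\<in>set [and_clause c d. c \<leftarrow> L, d \<leftarrow> L']. \<Gamma> \<union> clause_set e \<turnstile> \<chi>"
  show "\<Gamma> \<turnstile> \<chi>"
  proof (rule derives_normalD(3)[OF \<phi> L \<chi> derives.AndE1[OF *]], rule)
    fix c assume c: "c \<in> set L"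
    then have cc: "classical_clause c" using derives_normalD(1)[OF \<phi>] by blast
    let ?\<Gamma> = "\<Gamma> \<union> clause_set c"
    have L1: "?\<Gamma> \<subseteq> language" using L clause_in_language(1)[OF cc] by simp
    have "?\<Gamma> \<turnstile> \<psi>" by (rule weakening[OF derives.AndE2[OF *]]) simp
    then show "?\<Gamma> \<turnstile> \<chi>"
    proof (rule derives_normalD(3)[OF \<psi> L1 \<chi>], intro ballI)
      fix d assume d: "d \<in> set L'"
      then have dc: "classical_clause d" using derives_normalD(1)[OF \<psi>] by blast
      show "?\<Gamma> \<union> clause_set d \<turnstile> \<chi>"
      proof (rule cut_clause)
        show "\<Gamma> \<union> clause_set (and_clause c d) \<turnstile> \<chi>" using all c d by auto
        show "\<forall>\<gamma>\<in>clause_set (and_clause c d). ?\<Gamma> \<union> clause_set d \<turnstile> \<gamma>"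
          by (auto intro!: derives.AndI[OF derives.Ax derives.Ax] intro: derives.Ax
              simp: and_clause_def clause_set_def)
        show "classical_clause (and_clause c d)"
          using cc dc by (auto simp: and_clause_def classical_clause_def)
      qed (use L1 clause_in_language(1)[OF dc] in auto)
    qed
  qed
qed

text \<open>A split disjunction of the clauses \<open>K\<close> is a Boolean one over the subsets of \<open>K\<close>, where a subset
  stands for the clauses that are used on a nonempty part of the team.\<close>

lemma derives_normal_split:
  assumes cl: "\<forall>c\<in>set K. classical_clause c" and "\<forall>c\<in>set K. clause_set c \<turnstile> \<phi>"
    and disj: "{\<phi>} \<turnstile> disj K" and "in_ML b \<phi>"
  shows "derives_normal \<phi> (map merge (subseqs K))"
proof (rule derives_normalI)
  fix c assume "c \<in> set (map merge (subseqs K))"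
  then obtain K' where c: "c = merge K'" and K': "set K' \<subseteq> set K"
    using subseqs_powset[of K] by auto
  show "classical_clause c" unfolding c using K' cl by (intro classical_clause_merge) auto
  show "clause_set c \<turnstile> \<phi>" unfolding c by (rule merge_entails) (use K' cl assms(2,4) in blast)+
next
  fix \<Gamma> \<chi>
  assume L: "\<Gamma> \<subseteq> language" and \<chi>: "in_ML b \<chi>" and *: "\<Gamma> \<turnstile> \<phi>"
    and all: "\<forall>c\<in>set (map merge (subseqs K)). \<Gamma> \<union> clause_set c \<turnstile> \<chi>"
  have 1: "\<Gamma> \<turnstile> Or Bot (disj K)"
    by (rule derives.OrI2[OF cut_single[OF * disj]]) (use assms in simp_all)
  have 2: "\<forall>K'\<in>set (subseqs K). insert (Ors Bot (map fst K'))
      (\<Gamma> \<union> (\<lambda>\<beta>. \<nabla> \<beta>) ` set (snd (merge K'))) \<turnstile> \<chi>"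
    using all by (simp add: clause_set_def fst_merge)
  have m: "\<Gamma> \<turnstile> \<psi>" if "\<Gamma> \<turnstile> \<phi>" "{\<phi>} \<turnstile> \<psi>" "in_ML b \<phi>" for \<Gamma> \<phi> \<psi>
    using that by (rule cut_single)
  show "\<Gamma> \<turnstile> \<chi>"
    using split_cases[where F = "\<lambda>\<phi>. \<phi>" and G = "\<lambda>\<phi>. \<phi>", OF m OrBulE' refl refl L cl _ 1 2]
    by simp
qed

lemma derives_normal_Or:
  assumes \<phi>: "derives_normal \<phi> L" "in_ML b \<phi>" and \<psi>: "derives_normal \<psi> L'" "in_ML b \<psi>"
  shows "derives_normal (Or \<phi> \<psi>) (map merge (subseqs (L @ L')))"
proof (rule derives_normal_split)
  show cl: "\<forall>c\<in>set (L @ L'). classical_clause c"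
    using derives_normalD(1)[OF \<phi>(1)] derives_normalD(1)[OF \<psi>(1)] by auto
  show "\<forall>c\<in>set (L @ L'). clause_set c \<turnstile> Or \<phi> \<psi>"
  proof
    fix c assume "c \<in> set (L @ L')"
    then consider "c \<in> set L" | "c \<in> set L'" by auto
    then show "clause_set c \<turnstile> Or \<phi> \<psi>"
    proof cases
      case 1
      with derives_normalD(2)[OF \<phi>(1)] have "clause_set c \<turnstile> \<phi>" by blast
      then show ?thesis using \<psi>(2) by (rule derives.OrI1)
    next
      case 2
      with derives_normalD(2)[OF \<psi>(1)] have "clause_set c \<turnstile> \<psi>" by blast
      then show ?thesis using \<phi>(2) by (rule derives.OrI2)
    qed
  qed
  have *: "{disj K} \<turnstile> disj (L @ L')" if K: "set K \<subseteq> set (L @ L')" for K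
  proof (rule disj_elim[OF derives.Ax[OF singletonI]])
    show "\<forall>c\<in>set K. {clause_fm c} \<turnstile> disj (L @ L')"
    proof
      fix c assume "c \<in> set K"
      with K have "c \<in> set (L @ L')" by blast
      then show "{clause_fm c} \<turnstile> disj (L @ L')"
        by (rule disj_intro[OF _ derives.Ax[OF singletonI] cl])
    qed
  qed (rule disj_in_language[OF cl])
  have "{\<phi>} \<turnstile> disj (L @ L')"
    by (rule cut_single[OF entails_disj[OF \<phi>] *]) (use cl disj_in_language in auto)
  moreover have "{\<psi>} \<turnstile> disj (L @ L')"
    by (rule cut_single[OF entails_disj[OF \<psi>] *]) (use cl disj_in_language in auto)
  ultimately show "{Or \<phi> \<psi>} \<turnstile> disj (L @ L')"
    by (rule or_elim[OF derives.Ax[OF singletonI]])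
qed (use \<phi> \<psi> in simp)

text \<open>For a nonempty team some choice of successors satisfies the clause \<open>(\<alpha>, \<beta>s)\<close> iff every world
  sees an \<open>\<alpha>\<close>-world and, for each \<open>\<beta>\<close>, some world sees an \<open>\<alpha>\<close>-world satisfying \<open>\<beta>\<close>: the
  union of all \<open>\<alpha>\<close>-successors then is such a team.\<close>

definition dia_clause :: "'p clause \<Rightarrow> 'p clause"
  where "dia_clause c = (Dia (fst c), map (\<lambda>\<beta>. Dia (And (fst c) \<beta>)) (snd c))"

lemma Dia_Bot: "\<Gamma> \<turnstile> Dia Bot \<Longrightarrow> in_ML b \<chi> \<Longrightarrow> \<Gamma> \<turnstile> \<chi>"
proof -
  assume *: "\<Gamma> \<turnstile> Dia Bot" "in_ML b \<chi>"
  have "{Bot} \<turnstile> Neg (Neg Bot)" by (rule double_negI) simp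
  then have "\<Gamma> \<turnstile> Dia (Neg (Neg Bot))" using *(1) by (rule derives.DiaMon)
  then have "\<Gamma> \<turnstile> Neg (Box (Neg Bot))" by (rule derives.BoxDiaInter[rotated]) simp
  moreover have "\<Gamma> \<turnstile> Box (Neg Bot)"
    by (rule derives.BoxMon[of _ "[]"]) (simp_all add: top)
  ultimately show ?thesis
    using derives.NegE[of "Box (Neg Bot)" b \<Gamma> \<chi>] *(2) by simp
qed

lemma Dia_disj:
  assumes "\<forall>c\<in>set L. {Dia (clause_fm c)} \<turnstile> \<chi>" "in_ML b \<chi>"
  shows "\<Gamma> \<turnstile> Dia (disj L) \<Longrightarrow> \<Gamma> \<turnstile> \<chi>"
  using assms(1)
proof (induction L arbitrary: \<Gamma>)
  case Nil
  then show ?case using Dia_Bot assms(2) by simp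
next
  case (Cons c L)
  have 1: "{Dia (disj L)} \<turnstile> \<chi>" by (rule Cons.IH) (use Cons.prems in \<open>simp_all add: derives.Ax\<close>)
  have "\<Gamma> \<turnstile> Or (Dia (clause_fm c)) (Dia (disj L))"
    by (rule derives.DiaOrDistr) (use Cons.prems in simp)
  then show ?case by (rule or_elim[OF _ _ 1]) (use Cons.prems in simp)
qed

lemma derives_normal_Dia:
  assumes \<phi>: "derives_normal \<phi> L" "in_ML b \<phi>"
  shows "derives_normal (Dia \<phi>) (map merge (subseqs (map dia_clause L)))"
proof (rule derives_normal_split)
  note cl = derives_normalD(1)[OF \<phi>(1)]
  show dcl: "\<forall>c\<in>set (map dia_clause L). classical_clause c"
    using cl by (auto simp: classical_clause_def dia_clause_def)
  show "\<forall>c\<in>set (map dia_clause L). clause_set c \<turnstile> Dia \<phi>"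
  proof
    fix d assume "d \<in> set (map dia_clause L)"
    then obtain c where c: "c \<in> set L" and d: "d = dia_clause c" by auto
    have cc: "classical_clause c" using c cl by blast
    have D: "clause_set d \<turnstile> Dia (distributed c)"
      by (rule derives.BulDiaDistr) (auto intro!: derives.Ax simp: d dia_clause_def clause_set_def)
    have "{distributed c} \<turnstile> clause_fm c"
      by (rule distributed_entails) (use cc in \<open>simp add: classical_clause_def classical_in_ML\<close>)
    then have "{distributed c} \<turnstile> \<phi>"
      by (rule cut_single[OF _ clause_fm_entails])
        (use c cc derives_normalD(2)[OF \<phi>(1)] in \<open>simp_all add: clause_in_language\<close>)
    then show "clause_set d \<turnstile> Dia \<phi>" using D by (rule derives.DiaMon)
  qed
  show "{Dia \<phi>} \<turnstile> disj (map dia_clause L)"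
  proof (rule Dia_disj)
    show "{Dia \<phi>} \<turnstile> Dia (disj L)"
      by (rule derives.DiaMon[OF entails_disj[OF \<phi>] derives.Ax]) simp
    show "\<forall>c\<in>set L. {Dia (clause_fm c)} \<turnstile> disj (map dia_clause L)"
    proof
      fix c assume c: "c \<in> set L"
      then have cc: "classical_clause c" using cl by blast
      let ?F = "{Dia (clause_fm c)}"
      have Ax: "?F \<turnstile> Dia (clause_fm c)" by (rule derives.Ax) simp
      have "{clause_fm c} \<turnstile> fst c"
        by (rule clause_fm_entails[OF derives.Ax cc]) (simp add: clause_set_def)
      then have 1: "?F \<turnstile> Dia (fst c)" using Ax by (rule derives.DiaMon)
      have "?F \<turnstile> \<nabla> (Dia (And (fst c) \<beta>))" if "\<beta> \<in> set (snd c)" for \<beta>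
        by (rule derives.DiaBulDistr[OF derives.DiaMon[OF clause_fm_entails[OF clause_set_might] Ax]])
          (use cc that in simp_all)
      with 1 have "?F \<turnstile> clause_fm (dia_clause c)"
        by (auto simp: clause_fm_iff clause_set_def dia_clause_def)
      then show "?F \<turnstile> disj (map dia_clause L)"
        by (rule disj_intro[rotated]) (use c dcl in auto)
    qed
    show "in_ML b (disj (map dia_clause L))" by (rule disj_in_language[OF dcl])
  qed
qed (use \<phi> in simp)

text \<open>Below \<open>\<box>\<close> the case distinction is carried out on the clauses themselves rather than on their
  boxed forms, so merging comes first. The empty list yields \<open>\<box>\<bottom>\<close>, the case of a team without
  successors.\<close>

definition box_clause :: "'p clause list \<Rightarrow> 'p clause"
  where "box_clause K = (Box (fst (merge K)), map Dia (snd (merge K)))"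

lemma derives_normal_Box:
  assumes \<phi>: "derives_normal \<phi> L" "in_ML b \<phi>"
  shows "derives_normal (Box \<phi>) (map box_clause (subseqs L))"
proof (rule derives_normalI)
  note cl = derives_normalD(1)[OF \<phi>(1)]
  {
    fix c assume "c \<in> set (map box_clause (subseqs L))"
    then obtain K where c: "c = box_clause K" and K: "set K \<subseteq> set L"
      using subseqs_powset[of L] by auto
    have m: "classical_clause (merge K)" using K cl by (intro classical_clause_merge) auto
    then show "classical_clause c" by (auto simp: c box_clause_def classical_clause_def)
    let ?m = "fst (merge K) # map (\<lambda>\<beta>. \<nabla> \<beta>) (snd (merge K))"
    have ax: "\<gamma> \<in> clause_set c \<Longrightarrow> clause_set c \<turnstile> \<gamma>" for \<gamma> by (rule derives.Ax)
    have "set ?m \<turnstile> \<phi>"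
      using merge_entails[of K \<phi>] K cl derives_normalD(2)[OF \<phi>(1)] \<phi>(2)
      by (auto simp: clause_set_def)
    then show "clause_set c \<turnstile> Box \<phi>"
    proof (rule derives.BoxMon)
      have "clause_set c \<turnstile> Box (fst (merge K))"
        by (rule ax) (simp add: clause_set_def c box_clause_def)
      moreover have "clause_set c \<turnstile> Box (\<nabla> \<beta>)" if "\<beta> \<in> set (snd (merge K))" for \<beta>
        by (rule derives.DiaBoxBulExc[OF ax]) (use that in \<open>simp add: clause_set_def c box_clause_def\<close>)
      ultimately show "\<forall>\<gamma>\<in>set ?m. clause_set c \<turnstile> Box \<gamma>" by auto
    qed
  }
  fix \<Gamma> \<chi>
  assume L: "\<Gamma> \<subseteq> language" and \<chi>: "in_ML b \<chi>" and *: "\<Gamma> \<turnstile> Box \<phi>"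
    and all: "\<forall>c\<in>set (map box_clause (subseqs L)). \<Gamma> \<union> clause_set c \<turnstile> \<chi>"
  have mono: "\<Gamma> \<turnstile> Box \<psi>" if "\<Gamma> \<turnstile> Box \<phi>" "{\<phi>} \<turnstile> \<psi>" for \<Gamma> \<phi> \<psi>
    by (rule derives.BoxMon[of _ "[\<phi>]"]) (use that in simp_all)
  have "{\<phi>} \<turnstile> Or Bot (disj L)"
    by (rule derives.OrI2[OF entails_disj[OF \<phi>]]) simp
  with * have "\<Gamma> \<turnstile> Box (Or Bot (disj L))" by (rule mono)
  moreover have "\<forall>K'\<in>set (subseqs L). insert (Box (Ors Bot (map fst K')))
      (\<Gamma> \<union> (\<lambda>\<beta>. \<nabla> (Dia \<beta>)) ` set (snd (merge K'))) \<turnstile> \<chi>"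
    using all by (simp add: clause_set_def box_clause_def fst_merge image_image)
  ultimately show "\<Gamma> \<turnstile> \<chi>"
    by (rule split_cases[where F = Box and G = Dia, rotated -2])
      (rule mono BoxOrBulE' in_ML.simps L cl classical.simps(2)[THEN iffD2, OF TrueI]; assumption?)+
qed

text \<open>The first entry is a tautology, as nothing is claimed about all worlds. For the might operator the
  witnessing subteam may use different worlds for different requirements, whereas for its singular
  variant one world has to meet all of them.\<close>

definition might_clause :: "'p clause \<Rightarrow> 'p clause"
  where "might_clause c = (Neg Bot,
    case b of Might \<Rightarrow> fst c # map (And (fst c)) (snd c)
    | SingMight \<Rightarrow> [Ands (fst c) (snd c)])"

text \<open>The rule that joins two might formulas adds one requirement after the other.\<close>

lemma might_clauseI:
  assumes "b = Might" "\<Gamma> \<turnstile> \<nabla> \<alpha>" "\<forall>\<beta>\<in>set B. \<Gamma> \<turnstile> \<nabla> (And \<alpha> \<beta>)" "in_ML b \<alpha>" "\<forall>\<beta>\<in>set B. in_ML b \<beta>"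
  shows "\<Gamma> \<turnstile> \<nabla> (Ands \<alpha> (map (\<lambda>\<beta>. \<nabla> \<beta>) B))"
  using assms(3,5)
proof (induction B rule: rev_induct)
  case Nil
  then show ?case using assms(2) by simp
next
  case (snoc \<beta> B)
  let ?A = "Ands \<alpha> (map (\<lambda>\<beta>. \<nabla> \<beta>) B)" and ?C = "And \<alpha> \<beta>"
  let ?X = "Ands (Or ?A ?C) [\<nabla> ?A, \<nabla> ?C]"
  have X: "\<Gamma> \<turnstile> \<nabla> ?X"
    by (rule derives.MightJoin) (use snoc assms(1) in simp_all)
  have A: "{?A} \<turnstile> \<alpha>" "\<beta>' \<in> set B \<Longrightarrow> {?A} \<turnstile> \<nabla> \<beta>'" for \<beta>'
    using Ands_iff[of "{?A}" \<alpha> "map (\<lambda>\<beta>. \<nabla> \<beta>) B"] by (simp_all add: derives.Ax)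
  have C: "{?C} \<turnstile> \<alpha>" "{?C} \<turnstile> \<beta>"
    by (rule derives.AndE1[OF derives.Ax] derives.AndE2[OF derives.Ax]; simp)+
  have XE: "{?X} \<turnstile> Or ?A ?C" "{?X} \<turnstile> \<nabla> ?A" "{?X} \<turnstile> \<nabla> ?C"
    using Ands_iff[of "{?X}" "Or ?A ?C" "[\<nabla> ?A, \<nabla> ?C]"] derives.Ax[of ?X "{?X}" b]
    by (simp_all del: Ands_simps)
  have "{?X} \<turnstile> \<alpha>" by (rule or_elim[OF XE(1) A(1) C(1)])
  moreover have "{?X} \<turnstile> \<nabla> \<beta>'" if "\<beta>' \<in> set B" for \<beta>'
    by (rule might_might[OF might_mono[OF XE(2) A(2)[OF that]]])
  moreover have "{?X} \<turnstile> \<nabla> \<beta>" by (rule might_mono[OF XE(3) C(2)])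
  ultimately have "{?X} \<turnstile> Ands \<alpha> (map (\<lambda>\<beta>. \<nabla> \<beta>) (B @ [\<beta>]))"
    unfolding Ands_iff by auto
  then show ?case by (rule might_mono[OF X])
qed

text \<open>At a single world \<open>\<nabla>\<beta>\<close> amounts to \<open>\<beta>\<close>; the conjunction rule of the singular operator strips off
  these occurrences of \<open>\<nabla>\<close> one by one, each time the outermost of a suitably rotated conjunction.\<close>

lemma sing_might_Ands:
  assumes "b = SingMight"
  shows "\<Gamma> \<turnstile> \<nabla> (Ands \<theta> (map (\<lambda>\<beta>. \<nabla> \<beta>) B)) \<Longrightarrow> \<Gamma> \<turnstile> \<nabla> (Ands \<theta> B)"
proof (induction B arbitrary: \<theta>)
  case (Cons \<beta> B)
  have "\<Gamma> \<turnstile> \<nabla> (Ands (And \<theta> (\<nabla> \<beta>)) B)" by (rule Cons.IH) (use Cons.prems in simp)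
  moreover have "{Ands (And \<theta> (\<nabla> \<beta>)) B} \<turnstile> And (\<nabla> \<beta>) (Ands \<theta> B)" (is "?L \<turnstile> ?R")
  proof -
    have 1: "?L \<turnstile> And \<theta> (\<nabla> \<beta>)" and 2: "\<forall>\<chi>\<in>set B. ?L \<turnstile> \<chi>"
      using Ands_iff[of ?L "And \<theta> (\<nabla> \<beta>)" B] by (simp_all add: derives.Ax)
    have "?L \<turnstile> Ands \<theta> B" unfolding Ands_iff using derives.AndE1[OF 1] 2 by simp
    with derives.AndE2[OF 1] show ?thesis by (rule derives.AndI)
  qed
  ultimately have "\<Gamma> \<turnstile> \<nabla> (And (\<nabla> \<beta>) (Ands \<theta> B))" by (rule might_mono)
  with assms have "\<Gamma> \<turnstile> \<nabla> (And \<beta> (Ands \<theta> B))" by (rule derives.SingMightAndSimpl)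
  moreover have "{And \<beta> (Ands \<theta> B)} \<turnstile> Ands (And \<theta> \<beta>) B" (is "?L \<turnstile> ?R")
  proof -
    have *: "?L \<turnstile> \<beta>" "?L \<turnstile> Ands \<theta> B"
      by (rule derives.AndE1[OF derives.Ax] derives.AndE2[OF derives.Ax]; simp)+
    then have "?L \<turnstile> \<theta>" "\<forall>\<chi>\<in>set B. ?L \<turnstile> \<chi>" using Ands_iff by blast+
    with * show ?thesis unfolding Ands_iff[of ?L "And \<theta> \<beta>"] by (simp add: derives.AndI)
  qed
  ultimately show ?case unfolding Ands_simps by (rule might_mono)
qed simp

lemma might_disj:
  assumes "in_ML b \<chi>"
  shows "\<Gamma> \<turnstile> \<nabla> (disj L) \<Longrightarrow> \<forall>c\<in>set L. insert (\<nabla> (clause_fm c)) \<Gamma> \<turnstile> \<chi> \<Longrightarrow> \<Gamma> \<turnstile> \<chi>"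
proof (induction L arbitrary: \<Gamma>)
  case Nil
  then have "\<Gamma> \<turnstile> \<nabla> Bot" by simp
  with derives.BulNegE[OF _ top this assms] show ?case by simp
next
  case (Cons c L)
  have 1: "insert (\<nabla> (disj L)) \<Gamma> \<turnstile> \<chi>"
  proof (rule Cons.IH)
    show "\<forall>c\<in>set L. insert (\<nabla> (clause_fm c)) (insert (\<nabla> (disj L)) \<Gamma>) \<turnstile> \<chi>"
    proof
      fix d assume "d \<in> set L"
      with Cons.prems(2) have "insert (\<nabla> (clause_fm d)) \<Gamma> \<turnstile> \<chi>" by simp
      then show "insert (\<nabla> (clause_fm d)) (insert (\<nabla> (disj L)) \<Gamma>) \<turnstile> \<chi>"
        by (rule weakening) blast
    qed
  qed (simp add: derives.Ax)
  have "\<Gamma> \<turnstile> Or (\<nabla> (clause_fm c)) (\<nabla> (disj L))"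
    by (rule derives.BulOrDistr) (use Cons.prems in simp)
  then show ?case by (rule OrBulE'[OF _ _ 1]) (use Cons.prems in simp)
qed

lemma classical_might_clause: "classical_clause c \<Longrightarrow> classical_clause (might_clause c)"
  by (auto simp: classical_clause_def might_clause_def split: might_op.split)

lemma derives_normal_Bul:
  assumes \<phi>: "derives_normal \<phi> L" "in_ML b \<phi>"
  shows "derives_normal (\<nabla> \<phi>) (map might_clause L)"
proof (rule derives_normalI)
  note cl = derives_normalD(1)[OF \<phi>(1)]
  fix d assume "d \<in> set (map might_clause L)"
  then obtain c where c: "c \<in> set L" and d: "d = might_clause c" by auto
  have cc: "classical_clause c" using c cl by blast
  then show "classical_clause d" unfolding d by (rule classical_might_clause)
  have cf: "{clause_fm c} \<turnstile> \<phi>"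
    by (rule clause_fm_entails[OF _ cc]) (use c derives_normalD(2)[OF \<phi>(1)] in simp)
  have "clause_set d \<turnstile> \<nabla> (clause_fm c)"
  proof (cases b)
    case Might
    have e: "d = (Neg Bot, fst c # map (And (fst c)) (snd c))"
      unfolding d might_clause_def by (simp add: Might)
    show ?thesis
      unfolding clause_fm_def
      by (rule might_clauseI[OF Might])
        (use cc in \<open>auto intro!: derives.Ax
          simp: e clause_set_def classical_clause_def classical_in_ML\<close>)
  next
    case SingMight
    have e: "d = (Neg Bot, [Ands (fst c) (snd c)])"
      unfolding d might_clause_def by (simp add: SingMight)
    let ?F = "{Ands (fst c) (snd c)}"
    have *: "?F \<turnstile> fst c" "\<forall>\<beta>\<in>set (snd c). ?F \<turnstile> \<beta>"
      using Ands_iff[of ?F "fst c" "snd c"] by (simp_all add: derives.Ax)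
    then have "?F \<turnstile> clause_fm c"
      using cc unfolding clause_fm_def Ands_iff
      by (auto intro!: derives.BulI simp: classical_clause_def)
    then show ?thesis
      by (rule might_mono[rotated])
        (auto intro!: derives.Ax simp: e clause_set_def)
  qed
  then show "clause_set d \<turnstile> \<nabla> \<phi>" by (rule might_mono[OF _ cf])
next
  note cl = derives_normalD(1)[OF \<phi>(1)]
  fix \<Gamma> \<chi>
  assume L: "\<Gamma> \<subseteq> language" and \<chi>: "in_ML b \<chi>" and *: "\<Gamma> \<turnstile> \<nabla> \<phi>"
    and all: "\<forall>c\<in>set (map might_clause L). \<Gamma> \<union> clause_set c \<turnstile> \<chi>"
  show "\<Gamma> \<turnstile> \<chi>"
  proof (rule might_disj[OF \<chi> might_mono[OF * entails_disj[OF \<phi>]]], intro ballI)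
    fix c assume c: "c \<in> set L"
    then have cc: "classical_clause c" using cl by blast
    let ?\<Gamma> = "insert (\<nabla> (clause_fm c)) \<Gamma>"
    have m: "?\<Gamma> \<turnstile> \<nabla> (clause_fm c)" by (rule derives.Ax) simp
    show "?\<Gamma> \<turnstile> \<chi>"
    proof (rule cut_clause)
      show "\<Gamma> \<union> clause_set (might_clause c) \<turnstile> \<chi>" using all c by simp
      show "classical_clause (might_clause c)" by (rule classical_might_clause[OF cc])
      show "?\<Gamma> \<subseteq> language" using L clause_in_language(2)[OF cc] by simp
      show "\<forall>\<gamma>\<in>clause_set (might_clause c). ?\<Gamma> \<turnstile> \<gamma>"
      proof (cases b)
        case Might
        have e: "might_clause c = (Neg Bot, fst c # map (And (fst c)) (snd c))"
          unfolding might_clause_def by (simp add: Might)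
        have "?\<Gamma> \<turnstile> \<nabla> (fst c)"
          by (rule might_mono[OF m clause_fm_entails[OF derives.Ax cc]]) (simp add: clause_set_def)
        moreover have "?\<Gamma> \<turnstile> \<nabla> (And (fst c) \<beta>)" if "\<beta> \<in> set (snd c)" for \<beta>
          by (rule might_might[OF might_mono[OF m clause_fm_entails[OF clause_set_might]]])
            (use cc that in simp_all)
        ultimately show ?thesis
          unfolding clause_set_def e by (auto simp: top)
      next
        case SingMight
        have e: "might_clause c = (Neg Bot, [Ands (fst c) (snd c)])"
          unfolding might_clause_def by (simp add: SingMight)
        from SingMight have "?\<Gamma> \<turnstile> \<nabla> (Ands (fst c) (snd c))"
          using m unfolding clause_fm_def by - (rule sing_might_Ands)
        then show ?thesis
          unfolding clause_set_def e by (simp add: top)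
      qed
    qed blast
  qed
qed

end

section \<open>Normal forms in teams\<close>

lemma sat_empty: "sat M {} \<phi>"
  by (induction \<phi>) (auto simp: team_succ_def split: might_op.split)

text \<open>Closure under unions is the reason why several clauses that each imply \<open>\<phi>\<close> may be merged, and why
  \<open>\<phi> \<or> \<phi>\<close> implies \<open>\<phi>\<close>.\<close>

lemma sat_Union: "\<forall>T\<in>F. sat M T \<phi> \<Longrightarrow> sat M (\<Union>F) \<phi>"
proof (induction \<phi> arbitrary: F)
  case (Or \<phi> \<psi>)
  from Or.prems have "\<forall>T\<in>F. \<exists>T1 T2. T1 \<union> T2 = T \<and> sat M T1 \<phi> \<and> sat M T2 \<psi>"
    unfolding sat.simps by metis
  then obtain f g where fg: "\<forall>T\<in>F. f T \<union> g T = T" "\<forall>T\<in>F. sat M (f T) \<phi>" "\<forall>T\<in>F. sat M (g T) \<psi>"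
    by metis
  have "sat M (\<Union>(f ` F)) \<phi>" "sat M (\<Union>(g ` F)) \<psi>" using fg(2,3) by (simp_all add: Or.IH)
  moreover have "\<Union>F = \<Union>(f ` F) \<union> \<Union>(g ` F)"
    unfolding UN_Un_distrib[symmetric] using fg(1) by simp
  ultimately show ?case unfolding sat.simps by blast
next
  case (Dia \<phi>)
  then have "\<forall>T\<in>F. \<exists>S. team_succ (rel M) T S \<and> sat M S \<phi>" by simp
  then obtain f where f: "\<forall>T\<in>F. team_succ (rel M) T (f T)" "\<forall>T\<in>F. sat M (f T) \<phi>" by metis
  have "sat M (\<Union>(f ` F)) \<phi>" using f(2) by (simp add: Dia.IH)
  moreover have "team_succ (rel M) (\<Union>F) (\<Union>(f ` F))"
    using f(1) unfolding team_succ_def by blast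
  ultimately show ?case unfolding sat.simps by blast
next
  case (Box \<phi>)
  have "sat M (\<Union>((\<lambda>T. rel M `` T) ` F)) \<phi>"
    by (rule Box.IH) (use Box.prems in simp)
  moreover have "rel M `` \<Union>F = \<Union>((\<lambda>T. rel M `` T) ` F)" by blast
  ultimately show ?case by simp
next
  case (Bul c \<phi>)
  show ?case
  proof (cases c)
    case Might
    show ?thesis
    proof (cases "\<Union>F = {}")
      case False
      then obtain T where T: "T \<in> F" "T \<noteq> {}" by blast
      have "sat M T (Bul Might \<phi>)" using Bul.prems T(1) Might by blast
      with T(2) obtain S where "S \<noteq> {}" "S \<subseteq> T" "sat M S \<phi>" by auto
      moreover from T(1) have "T \<subseteq> \<Union>F" by blast
      ultimately have "\<exists>S. S \<noteq> {} \<and> S \<subseteq> \<Union>F \<and> sat M S \<phi>" by blast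
      with Might show ?thesis by simp
    qed (simp only: sat_empty)
  next
    case SingMight
    show ?thesis
    proof (cases "\<Union>F = {}")
      case False
      then obtain T where T: "T \<in> F" "T \<noteq> {}" by blast
      have "sat M T (Bul SingMight \<phi>)" using Bul.prems T(1) SingMight by blast
      with T(2) obtain w where "w \<in> T" "sat M {w} \<phi>" by auto
      with T(1) SingMight show ?thesis by auto
    qed (simp only: sat_empty)
  qed
next
  case (And \<phi> \<psi>)
  then show ?case unfolding sat.simps by blast
qed auto

lemma sat_world_Or:
  "sat M {w} (Or \<alpha> \<beta>) \<longleftrightarrow> sat M {w} \<alpha> \<or> sat M {w} \<beta>"
proof
  assume "sat M {w} (Or \<alpha> \<beta>)"
  then obtain A B where AB: "{w} = A \<union> B" "sat M A \<alpha>" "sat M B \<beta>" by auto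
  then consider "A = {w}" | "B = {w}" by blast
  then show "sat M {w} \<alpha> \<or> sat M {w} \<beta>" by cases (use AB in auto)
next
  assume "sat M {w} \<alpha> \<or> sat M {w} \<beta>"
  then show "sat M {w} (Or \<alpha> \<beta>)"
    using sat_empty[of M \<alpha>] sat_empty[of M \<beta>] by (metis sat.simps(4) sup_bot_left sup_bot_right)
qed

text \<open>Classical formulas are evaluated world by world, so at the level of clauses team semantics
  reduces to ordinary Kripke semantics.\<close>

lemma flat: "classical \<alpha> \<Longrightarrow> sat M T \<alpha> \<longleftrightarrow> (\<forall>w\<in>T. sat M {w} \<alpha>)"
proof (induction \<alpha> arbitrary: T)
  case (Neg \<alpha>)
  show ?case by simp
next
  case (And \<alpha> \<beta>)
  from And.IH(1)[of T] And.IH(2)[of T] And.prems show ?case by auto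
next
  case (Or \<alpha> \<beta>)
  have world: "sat M {w} (Or \<alpha> \<beta>) \<longleftrightarrow> sat M {w} \<alpha> \<or> sat M {w} \<beta>" for w by (rule sat_world_Or)
  from Or.prems have IH: "sat M S \<alpha> \<longleftrightarrow> (\<forall>w\<in>S. sat M {w} \<alpha>)" "sat M S \<beta> \<longleftrightarrow> (\<forall>w\<in>S. sat M {w} \<beta>)" for S
    using Or.IH by (metis classical.simps(4))+
  show ?case
  proof
    assume "sat M T (Or \<alpha> \<beta>)"
    then obtain A B where AB: "T = A \<union> B" "sat M A \<alpha>" "sat M B \<beta>" by auto
    from AB(2,3)[unfolded IH(1)[of A] IH(2)[of B]] show "\<forall>w\<in>T. sat M {w} (Or \<alpha> \<beta>)"
      unfolding world AB(1) by blast
  next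
    assume a: "\<forall>w\<in>T. sat M {w} (Or \<alpha> \<beta>)"
    let ?A = "{w\<in>T. sat M {w} \<alpha>}" and ?B = "{w\<in>T. sat M {w} \<beta>}"
    have "T = ?A \<union> ?B" using a unfolding world by blast
    moreover have "sat M ?A \<alpha>" using IH(1)[of ?A] by blast
    moreover have "sat M ?B \<beta>" using IH(2)[of ?B] by blast
    ultimately show "sat M T (Or \<alpha> \<beta>)" unfolding sat.simps by blast
  qed
next
  case (Dia \<alpha>)
  from Dia have IH: "sat M S \<alpha> \<longleftrightarrow> (\<forall>w\<in>S. sat M {w} \<alpha>)" for S by (metis classical.simps(6))
  show ?case
  proof
    assume "sat M T (Dia \<alpha>)"
    then obtain S where S: "team_succ (rel M) T S" "sat M S \<alpha>" by auto
    show "\<forall>w\<in>T. sat M {w} (Dia \<alpha>)"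
    proof
      fix w assume "w \<in> T"
      let ?S = "S \<inter> rel M `` {w}"
      have "team_succ (rel M) {w} ?S" using S(1) \<open>w \<in> T\<close> unfolding team_succ_def by blast
      moreover have "sat M ?S \<alpha>" using IH[of S] IH[of ?S] S(2) by blast
      ultimately show "sat M {w} (Dia \<alpha>)" unfolding sat.simps by blast
    qed
  next
    assume a: "\<forall>w\<in>T. sat M {w} (Dia \<alpha>)"
    let ?S = "{v \<in> rel M `` T. sat M {v} \<alpha>}"
    have "team_succ (rel M) T ?S"
      unfolding team_succ_def
    proof
      show "T \<subseteq> (rel M)\<inverse> `` ?S"
      proof
        fix w assume w: "w \<in> T"
        with a obtain S where S: "team_succ (rel M) {w} S" "sat M S \<alpha>" by auto
        then obtain v where v: "v \<in> S" "(w, v) \<in> rel M" unfolding team_succ_def by blast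
        then have "sat M {v} \<alpha>" using S(2) IH[of S] by blast
        with v w show "w \<in> (rel M)\<inverse> `` ?S" by blast
      qed
    qed blast
    moreover have "sat M ?S \<alpha>" using IH[of ?S] by blast
    ultimately show "sat M T (Dia \<alpha>)" unfolding sat.simps by blast
  qed
next
  case (Box \<alpha>)
  then have IH: "sat M S \<alpha> \<longleftrightarrow> (\<forall>w\<in>S. sat M {w} \<alpha>)" for S by (metis classical.simps(7))
  have "(\<forall>w\<in>T. sat M (rel M `` {w}) \<alpha>) \<longleftrightarrow> (\<forall>w\<in>T. \<forall>v\<in>rel M `` {w}. sat M {v} \<alpha>)"
    by (intro ball_cong refl IH)
  also have "\<dots> \<longleftrightarrow> (\<forall>v\<in>rel M `` T. sat M {v} \<alpha>)" by blast
  also have "\<dots> \<longleftrightarrow> sat M (rel M `` T) \<alpha>" by (rule IH[symmetric])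
  finally show ?case unfolding sat.simps by (rule sym)
qed auto

lemma sat_world_Dia:
  assumes "classical \<alpha>"
  shows "sat M {w} (Dia \<alpha>) \<longleftrightarrow> (\<exists>v. (w, v) \<in> rel M \<and> sat M {v} \<alpha>)"
proof
  assume "sat M {w} (Dia \<alpha>)"
  then obtain S where S: "team_succ (rel M) {w} S" "sat M S \<alpha>" by auto
  then obtain v where "v \<in> S" "(w, v) \<in> rel M" unfolding team_succ_def by blast
  with S flat[OF assms, of M S] show "\<exists>v. (w, v) \<in> rel M \<and> sat M {v} \<alpha>" by blast
next
  assume "\<exists>v. (w, v) \<in> rel M \<and> sat M {v} \<alpha>"
  then obtain v where "(w, v) \<in> rel M" "sat M {v} \<alpha>" by blast
  then show "sat M {w} (Dia \<alpha>)"
    unfolding sat.simps by (intro exI[of _ "{v}"]) (auto simp: team_succ_def)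
qed

lemma sat_world_Box:
  assumes "classical \<alpha>"
  shows "sat M {w} (Box \<alpha>) \<longleftrightarrow> (\<forall>v. (w, v) \<in> rel M \<longrightarrow> sat M {v} \<alpha>)"
  using flat[OF assms, of M "rel M `` {w}"] by auto

lemma sat_world_Ors:
  "classical \<sigma> \<Longrightarrow> \<forall>\<alpha>\<in>set \<alpha>s. classical \<alpha> \<Longrightarrow>
    sat M {w} (Ors \<sigma> \<alpha>s) \<longleftrightarrow> sat M {w} \<sigma> \<or> (\<exists>\<alpha>\<in>set \<alpha>s. sat M {w} \<alpha>)"
proof (induction \<alpha>s arbitrary: \<sigma>)
  case (Cons \<alpha> \<alpha>s)
  then show ?case using sat_world_Or[of M w \<sigma> \<alpha>] by (simp del: sat.simps)
qed simp

lemma sat_Ands: "sat M T (Ands \<phi> \<chi>s) \<longleftrightarrow> sat M T \<phi> \<and> (\<forall>\<chi>\<in>set \<chi>s. sat M T \<chi>)"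
  by (induction \<chi>s arbitrary: \<phi>) auto

text \<open>Satisfaction of a clause expressed through single worlds, which covers both operators alike. The
  empty team satisfies every clause.\<close>

definition sat_clause :: "('p, 'w) kripke \<Rightarrow> 'w set \<Rightarrow> 'p clause \<Rightarrow> bool"
  where "sat_clause M T c \<longleftrightarrow> (\<forall>w\<in>T. sat M {w} (fst c)) \<and>
    (T = {} \<or> (\<forall>\<beta>\<in>set (snd c). \<exists>w\<in>T. sat M {w} \<beta>))"

definition sat_normal :: "('p, 'w) kripke \<Rightarrow> 'p fm \<Rightarrow> 'p clause list \<Rightarrow> bool"
  where "sat_normal M \<phi> L \<longleftrightarrow> (\<forall>T. sat M T \<phi> \<longleftrightarrow> (\<exists>c\<in>set L. sat_clause M T c))"

lemma sat_clause_empty: "sat_clause M {} c"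
  by (simp add: sat_clause_def)

lemma sat_clause_merge:
  assumes "\<forall>c\<in>set K. classical_clause c" "T \<noteq> {}"
  shows "sat_clause M T (merge K) \<longleftrightarrow>
    (\<forall>w\<in>T. \<exists>c\<in>set K. sat M {w} (fst c)) \<and>
    (\<forall>c\<in>set K. \<forall>\<beta>\<in>set (snd c). \<exists>w\<in>T. sat M {w} (fst c) \<and> sat M {w} \<beta>)"
proof -
  have "sat M {w} (Ors Bot (map fst K)) \<longleftrightarrow> (\<exists>c\<in>set K. sat M {w} (fst c))" for w
    using assms(1) by (subst sat_world_Ors) (auto simp: classical_clause_def)
  with assms(2) show ?thesis
    by (auto simp: sat_clause_def fst_merge set_snd_merge)
qed

text \<open>Each clause of \<open>K\<close> is satisfied by the part of \<open>T\<close> where its first entry holds; these parts cover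
  \<open>T\<close>, and \<open>\<phi>\<close> is closed under unions.\<close>

lemma merge_sound:
  assumes cl: "\<forall>c\<in>set K. classical_clause c"
    and sound: "\<forall>c\<in>set K. \<forall>T. sat_clause M T c \<longrightarrow> sat M T \<phi>"
    and T: "sat_clause M T (merge K)"
  shows "sat M T \<phi>"
proof (cases "T = {}")
  case True
  then show ?thesis by (simp add: sat_empty)
next
  case False
  let ?T = "\<lambda>c. {w\<in>T. sat M {w} (fst c)}"
  note * = T[unfolded sat_clause_merge[OF cl False]]
  have "sat M (\<Union>(?T ` set K)) \<phi>"
  proof (rule sat_Union, clarify)
    fix c assume c: "c \<in> set K"
    with * have "sat_clause M (?T c) c" unfolding sat_clause_def by blast
    with sound c show "sat M (?T c) \<phi>" by blast
  qed
  moreover have "\<Union>(?T ` set K) = T" using * by blast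
  ultimately show ?thesis by simp
qed

text \<open>Counterpart of \<open>derives_normal_split\<close>. The clauses that hold on a nonempty part of the team form
  the subset to be merged.\<close>

lemma sat_normal_split:
  assumes cl: "\<forall>c\<in>set K. classical_clause c"
    and sound: "\<forall>c\<in>set K. \<forall>T. sat_clause M T c \<longrightarrow> sat M T \<phi>"
    and complete: "\<And>T. sat M T \<phi> \<Longrightarrow> \<exists>F. \<Union>F = T \<and> (\<forall>S\<in>F. \<exists>c\<in>set K. sat_clause M S c)"
  shows "sat_normal M \<phi> (map merge (subseqs K))"
  unfolding sat_normal_def
proof (intro allI iffI)
  fix T assume "\<exists>c\<in>set (map merge (subseqs K)). sat_clause M T c"
  then obtain K' where K': "set K' \<subseteq> set K" "sat_clause M T (merge K')"
    using subseqs_powset[of K] by auto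
  show "sat M T \<phi>"
    by (rule merge_sound[OF _ _ K'(2)]) (use K'(1) cl sound in blast)+
next
  fix T assume "sat M T \<phi>"
  from complete[OF this] obtain F where F: "\<Union>F = T" "\<forall>S\<in>F. \<exists>c\<in>set K. sat_clause M S c" by blast
  let ?C = "{c\<in>set K. \<exists>S\<in>F. S \<noteq> {} \<and> sat_clause M S c}"
  have "?C \<in> set ` set (subseqs K)" unfolding subseqs_powset by blast
  then obtain K' where K': "K' \<in> set (subseqs K)" "set K' = ?C" by auto
  have "sat_clause M T (merge K')"
  proof (cases "T = {}")
    case False
    have cl': "\<forall>c\<in>set K'. classical_clause c" using cl K'(2) by blast
    show ?thesis
      unfolding sat_clause_merge[OF cl' False]
    proof (intro conjI ballI)
      fix w assume "w \<in> T"
      then obtain S where S: "S \<in> F" "w \<in> S" using F(1) by blast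
      then obtain c where "c \<in> set K" "sat_clause M S c" using F(2) by blast
      with S K'(2) show "\<exists>c\<in>set K'. sat M {w} (fst c)" unfolding sat_clause_def by blast
    next
      fix c \<beta> assume c: "c \<in> set K'" and \<beta>: "\<beta> \<in> set (snd c)"
      then obtain S where S: "S \<in> F" "S \<noteq> {}" "sat_clause M S c" using K'(2) by blast
      with \<beta> obtain w where "w \<in> S" "sat M {w} (fst c)" "sat M {w} \<beta>"
        unfolding sat_clause_def by blast
      then show "\<exists>w\<in>T. sat M {w} (fst c) \<and> sat M {w} \<beta>" using S(1) F(1) by blast
    qed
  qed (simp add: sat_clause_empty)
  with K'(1) show "\<exists>c\<in>set (map merge (subseqs K)). sat_clause M T c" by auto
qed

lemma sat_normal_classical: "classical \<alpha> \<Longrightarrow> sat_normal M \<alpha> [(\<alpha>, [])]"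
  by (simp add: sat_normal_def sat_clause_def flat[of \<alpha> M, symmetric])

lemma sat_normal_Or:
  assumes "\<forall>c\<in>set (L @ L'). classical_clause c" "sat_normal M \<phi> L" "sat_normal M \<psi> L'"
  shows "sat_normal M (Or \<phi> \<psi>) (map merge (subseqs (L @ L')))"
proof (rule sat_normal_split[OF assms(1)])
  have *: "sat M T \<phi> \<or> sat M T \<psi> \<Longrightarrow> sat M T (Or \<phi> \<psi>)" for T
    using sat_empty[of M \<phi>] sat_empty[of M \<psi>] by (metis sat.simps(4) sup_bot_left sup_bot_right)
  show "\<forall>c\<in>set (L @ L'). \<forall>T. sat_clause M T c \<longrightarrow> sat M T (Or \<phi> \<psi>)"
  proof (intro ballI allI impI)
    fix c T assume "c \<in> set (L @ L')" "sat_clause M T c"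
    then have "sat M T \<phi> \<or> sat M T \<psi>" using assms(2,3) unfolding sat_normal_def set_append by blast
    then show "sat M T (Or \<phi> \<psi>)" by (rule *)
  qed
next
  fix T assume "sat M T (Or \<phi> \<psi>)"
  then obtain A B where "T = A \<union> B" "sat M A \<phi>" "sat M B \<psi>" by auto
  with assms(2,3) show "\<exists>F. \<Union>F = T \<and> (\<forall>S\<in>F. \<exists>c\<in>set (L @ L'). sat_clause M S c)"
    unfolding sat_normal_def by (intro exI[of _ "{A, B}"]) auto
qed

context might_logic
begin

lemma sat_normal_And:
  assumes "sat_normal M \<phi> L" "sat_normal M \<psi> L'"
  shows "sat_normal M (And \<phi> \<psi>) [and_clause c d. c \<leftarrow> L, d \<leftarrow> L']"
proof -
  have "sat_clause M T (and_clause c d) \<longleftrightarrow> sat_clause M T c \<and> sat_clause M T d" for T c d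
    by (auto simp: sat_clause_def and_clause_def)
  with assms show ?thesis by (auto simp: sat_normal_def)
qed

text \<open>From right to left a requirement of the clause is met in \<open>S\<close> at a successor of some world of \<open>T\<close>;
  from left to right the set of all successors that satisfy the first entry is a suitable \<open>S\<close>.\<close>

lemma sat_dia_clause:
  assumes "classical_clause c"
  shows "sat_clause M T (dia_clause c) \<longleftrightarrow> (\<exists>S. team_succ (rel M) T S \<and> sat_clause M S c)"
proof
  have cl: "classical (fst c)" "\<forall>\<beta>\<in>set (snd c). classical (And (fst c) \<beta>)"
    using assms by (simp_all add: classical_clause_def)
  assume T: "sat_clause M T (dia_clause c)"
  let ?S = "{v \<in> rel M `` T. sat M {v} (fst c)}"
  have 1: "\<forall>w\<in>T. \<exists>v. (w, v) \<in> rel M \<and> sat M {v} (fst c)"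
    using T cl by (simp add: sat_clause_def dia_clause_def sat_world_Dia del: sat.simps)
  have 2: "T = {} \<or> (\<forall>\<beta>\<in>set (snd c). \<exists>w\<in>T. \<exists>v. (w, v) \<in> rel M \<and> sat M {v} (And (fst c) \<beta>))"
    using T cl by (simp add: sat_clause_def dia_clause_def sat_world_Dia del: sat.simps)
  have "team_succ (rel M) T ?S" using 1 unfolding team_succ_def by blast
  moreover have "sat_clause M ?S c" using 2 unfolding sat_clause_def by fastforce
  ultimately show "\<exists>S. team_succ (rel M) T S \<and> sat_clause M S c" by blast
next
  have cl: "classical (fst c)" "\<forall>\<beta>\<in>set (snd c). classical (And (fst c) \<beta>)"
    using assms by (simp_all add: classical_clause_def)
  assume "\<exists>S. team_succ (rel M) T S \<and> sat_clause M S c"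
  then obtain S where S: "team_succ (rel M) T S" "sat_clause M S c" by blast
  have 1: "\<exists>v. (w, v) \<in> rel M \<and> sat M {v} (fst c)" if "w \<in> T" for w
    using S that unfolding team_succ_def sat_clause_def by blast
  have 2: "\<exists>w\<in>T. \<exists>v. (w, v) \<in> rel M \<and> sat M {v} (And (fst c) \<beta>)"
    if T: "T \<noteq> {}" and \<beta>: "\<beta> \<in> set (snd c)" for \<beta>
  proof -
    have "S \<noteq> {}" using T S(1) unfolding team_succ_def by blast
    then obtain v where "v \<in> S" "sat M {v} \<beta>" "sat M {v} (fst c)"
      using S(2) \<beta> unfolding sat_clause_def by blast
    then show ?thesis using S(1) unfolding team_succ_def by fastforce
  qed
  from 1 2 cl show "sat_clause M T (dia_clause c)"
    by (auto simp add: sat_clause_def dia_clause_def sat_world_Dia simp del: sat.simps)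
qed

lemma sat_normal_Dia:
  assumes cl: "\<forall>c\<in>set L. classical_clause c" and \<phi>: "sat_normal M \<phi> L"
  shows "sat_normal M (Dia \<phi>) (map merge (subseqs (map dia_clause L)))"
proof (rule sat_normal_split)
  show "\<forall>c\<in>set (map dia_clause L). classical_clause c"
    using cl by (auto simp: classical_clause_def dia_clause_def)
  show "\<forall>c\<in>set (map dia_clause L). \<forall>T. sat_clause M T c \<longrightarrow> sat M T (Dia \<phi>)"
    using cl \<phi> sat_dia_clause unfolding sat_normal_def by fastforce
next
  fix T assume "sat M T (Dia \<phi>)"
  then obtain S c where "team_succ (rel M) T S" "c \<in> set L" "sat_clause M S c"
    using \<phi> unfolding sat_normal_def by auto
  then have "sat_clause M T (dia_clause c)" using cl sat_dia_clause by blast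
  with \<open>c \<in> set L\<close> show "\<exists>F. \<Union>F = T \<and> (\<forall>S\<in>F. \<exists>c\<in>set (map dia_clause L). sat_clause M S c)"
    by (intro exI[of _ "{T}"]) auto
qed

text \<open>The additional condition concerns a team whose set of successors is empty, and hence satisfies
  every clause; but a formula \<open>\<nabla>\<diamond>\<beta>\<close> can hold in a nonempty team only if there are successors.\<close>

lemma sat_box_clause:
  assumes "\<forall>c\<in>set K. classical_clause c"
  shows "sat_clause M T (box_clause K) \<longleftrightarrow> sat_clause M (rel M `` T) (merge K) \<and>
    (T \<noteq> {} \<longrightarrow> snd (merge K) \<noteq> [] \<longrightarrow> rel M `` T \<noteq> {})"
proof -
  have "classical_clause (merge K)" using assms by (rule classical_clause_merge)
  then have cl: "classical (fst (merge K))" "\<forall>\<beta>\<in>set (snd (merge K)). classical \<beta>"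
    by (simp_all add: classical_clause_def)
  let ?Q = "\<forall>\<beta>\<in>set (snd (merge K)). \<exists>v\<in>rel M `` T. sat M {v} \<beta>"
  have "(\<forall>w\<in>T. sat M {w} (Box (fst (merge K)))) \<longleftrightarrow> (\<forall>v\<in>rel M `` T. sat M {v} (fst (merge K)))"
    unfolding sat_world_Box[OF cl(1)] by blast
  moreover have "(\<exists>w\<in>T. sat M {w} (Dia \<beta>)) \<longleftrightarrow> (\<exists>v\<in>rel M `` T. sat M {v} \<beta>)"
    if "\<beta> \<in> set (snd (merge K))" for \<beta>
    using cl(2) that by (subst sat_world_Dia) blast+
  then have "(\<forall>\<beta>\<in>set (map Dia (snd (merge K))). \<exists>w\<in>T. sat M {w} \<beta>) \<longleftrightarrow> ?Q"
    by (simp del: sat.simps)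
  moreover have "?Q \<longleftrightarrow> snd (merge K) = [] \<or> rel M `` T \<noteq> {} \<and> ?Q"
    by (cases "snd (merge K)") auto
  ultimately show ?thesis
    unfolding sat_clause_def box_clause_def fst_conv snd_conv by blast
qed

lemma sat_normal_Box:
  assumes cl: "\<forall>c\<in>set L. classical_clause c" and \<phi>: "sat_normal M \<phi> L"
  shows "sat_normal M (Box \<phi>) (map box_clause (subseqs L))"
  unfolding sat_normal_def
proof (intro allI iffI)
  fix T assume "\<exists>c\<in>set (map box_clause (subseqs L)). sat_clause M T c"
  then obtain K where K: "set K \<subseteq> set L" "sat_clause M T (box_clause K)"
    using subseqs_powset[of L] by auto
  then have "sat_clause M (rel M `` T) (merge K)" using sat_box_clause[of K M T] cl by blast
  then have "sat M (rel M `` T) \<phi>"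
    by (rule merge_sound[rotated 2]) (use K(1) cl \<phi> in \<open>auto simp: sat_normal_def\<close>)
  then show "sat M T (Box \<phi>)" by simp
next
  fix T assume "sat M T (Box \<phi>)"
  then obtain c where c: "c \<in> set L" "sat_clause M (rel M `` T) c"
    using \<phi> unfolding sat_normal_def by auto
  let ?C = "if rel M `` T = {} then {} else {c}"
  have "?C \<in> set ` set (subseqs L)" unfolding subseqs_powset using c(1) by simp
  then obtain K where K: "K \<in> set (subseqs L)" "set K = ?C" by auto
  have cl': "\<forall>c\<in>set K. classical_clause c" using K(2) cl c(1) by (auto split: if_splits)
  have "sat_clause M T (box_clause K)"
  proof (cases "rel M `` T = {}")
    case True
    with K(2) have "K = []" by simp
    with True show ?thesis
      unfolding sat_box_clause[OF cl'] by (simp add: sat_clause_empty merge_def)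
  next
    case False
    with K(2) have set_K: "set K = {c}" by simp
    have 1: "\<forall>w\<in>rel M `` T. sat M {w} (fst c)"
      and 2: "\<forall>\<beta>\<in>set (snd c). \<exists>w\<in>rel M `` T. sat M {w} \<beta>"
      using c(2) False unfolding sat_clause_def by simp_all
    then have "\<forall>\<beta>\<in>set (snd c). \<exists>w\<in>rel M `` T. sat M {w} (fst c) \<and> sat M {w} \<beta>" by blast
    with 1 have "sat_clause M (rel M `` T) (merge K)"
      unfolding sat_clause_merge[OF cl' False] set_K by simp
    with False show ?thesis unfolding sat_box_clause[OF cl'] by simp
  qed
  with K(1) show "\<exists>c\<in>set (map box_clause (subseqs L)). sat_clause M T c" by auto
qed

lemma sat_might_clause:
  assumes cl: "classical_clause c" and T: "T \<noteq> {}"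
  shows "sat_clause M T (might_clause c) \<longleftrightarrow>
    (case b of Might \<Rightarrow> \<exists>S. S \<noteq> {} \<and> S \<subseteq> T \<and> sat_clause M S c | SingMight \<Rightarrow> \<exists>w\<in>T. sat_clause M {w} c)"
proof (cases b)
  case Might
  have e: "might_clause c = (Neg Bot, fst c # map (And (fst c)) (snd c))"
    unfolding might_clause_def by (simp add: Might)
  have "sat_clause M T (might_clause c) \<longleftrightarrow> (\<exists>w\<in>T. sat M {w} (fst c)) \<and>
      (\<forall>\<beta>\<in>set (snd c). \<exists>w\<in>T. sat M {w} (fst c) \<and> sat M {w} \<beta>)"
    using T unfolding e sat_clause_def by auto
  also have "\<dots> \<longleftrightarrow> (\<exists>S. S \<noteq> {} \<and> S \<subseteq> T \<and> sat_clause M S c)" (is "?l \<longleftrightarrow> ?r")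
  proof
    assume ?l
    then show ?r
      unfolding sat_clause_def by (intro exI[of _ "{w\<in>T. sat M {w} (fst c)}"]) blast
  next
    assume ?r then show ?l unfolding sat_clause_def by blast
  qed
  finally show ?thesis using Might by simp
next
  case SingMight
  have e: "might_clause c = (Neg Bot, [Ands (fst c) (snd c)])"
    unfolding might_clause_def by (simp add: SingMight)
  show ?thesis using T unfolding e sat_clause_def by (simp add: SingMight sat_Ands)
qed

lemma sat_normal_Bul:
  assumes cl: "\<forall>c\<in>set L. classical_clause c" and \<phi>: "sat_normal M \<phi> L"
  shows "sat_normal M (\<nabla> \<phi>) (map might_clause L)"
  unfolding sat_normal_def
proof
  fix T
  have ne: "L \<noteq> []" using \<phi> sat_empty[of M \<phi>] unfolding sat_normal_def by fastforce
  show "sat M T (\<nabla> \<phi>) \<longleftrightarrow> (\<exists>c\<in>set (map might_clause L). sat_clause M T c)"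
  proof (cases "T = {}")
    case True
    from ne have "\<exists>c. c \<in> set (map might_clause L)" by (metis list.set_sel(1) map_is_Nil_conv)
    with True show ?thesis using sat_empty sat_clause_empty by blast
  next
    case False
    have "sat M T (\<nabla> \<phi>) \<longleftrightarrow> (\<exists>c\<in>set L. case b of Might \<Rightarrow> \<exists>S. S \<noteq> {} \<and> S \<subseteq> T \<and> sat_clause M S c
        | SingMight \<Rightarrow> \<exists>w\<in>T. sat_clause M {w} c)"
    proof (cases b)
      case Might
      then have "sat M T (\<nabla> \<phi>) \<longleftrightarrow> (\<exists>S. S \<noteq> {} \<and> S \<subseteq> T \<and> sat M S \<phi>)" using False by simp
      also have "\<dots> \<longleftrightarrow> (\<exists>c\<in>set L. \<exists>S. S \<noteq> {} \<and> S \<subseteq> T \<and> sat_clause M S c)"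
        unfolding \<phi>[unfolded sat_normal_def, rule_format] by blast
      finally show ?thesis using Might by simp
    next
      case SingMight
      then have "sat M T (\<nabla> \<phi>) \<longleftrightarrow> (\<exists>w\<in>T. sat M {w} \<phi>)" using False by simp
      also have "\<dots> \<longleftrightarrow> (\<exists>c\<in>set L. \<exists>w\<in>T. sat_clause M {w} c)"
        unfolding \<phi>[unfolded sat_normal_def, rule_format] by blast
      finally show ?thesis using SingMight by simp
    qed
    also have "\<dots> \<longleftrightarrow> (\<exists>c\<in>set L. sat_clause M T (might_clause c))"
      using cl by (intro bex_cong refl sat_might_clause[OF _ False, symmetric]) blast
    finally show ?thesis by simp
  qed
qed

text \<open>The same clauses serve derivations and teams, and in every model; this is what transfers
  membership in a maximal set to satisfaction by a team.\<close>

theorem normal_form: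
  "in_ML b \<phi> \<Longrightarrow> \<exists>L. derives_normal \<phi> L \<and> (\<forall>M :: ('p, 'w) kripke. sat_normal M \<phi> L)"
proof (induction \<phi>)
  case (Or \<phi> \<psi>)
  then obtain L L' where L: "derives_normal \<phi> L" "\<forall>M :: ('p, 'w) kripke. sat_normal M \<phi> L"
      "derives_normal \<psi> L'" "\<forall>M :: ('p, 'w) kripke. sat_normal M \<psi> L'"
    by auto
  have "\<forall>c\<in>set (L @ L'). classical_clause c"
    using derives_normalD(1)[OF L(1)] derives_normalD(1)[OF L(3)] by auto
  then have "\<forall>M :: ('p, 'w) kripke. sat_normal M (Or \<phi> \<psi>) (map merge (subseqs (L @ L')))"
    using sat_normal_Or L(2,4) by blast
  moreover have "derives_normal (Or \<phi> \<psi>) (map merge (subseqs (L @ L')))"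
    by (rule derives_normal_Or[OF L(1) _ L(3)]) (use Or.prems in simp_all)
  ultimately show ?case by blast
next
  case (And \<phi> \<psi>)
  then obtain L L' where L: "derives_normal \<phi> L" "\<forall>M :: ('p, 'w) kripke. sat_normal M \<phi> L"
      "derives_normal \<psi> L'" "\<forall>M :: ('p, 'w) kripke. sat_normal M \<psi> L'"
    by auto
  then show ?case using derives_normal_And sat_normal_And by blast
next
  case (Dia \<phi>)
  then obtain L where L: "derives_normal \<phi> L" "\<forall>M :: ('p, 'w) kripke. sat_normal M \<phi> L" by auto
  with Dia.prems show ?case
    using derives_normal_Dia[OF L(1)] sat_normal_Dia[OF derives_normalD(1)[OF L(1)]] by auto
next
  case (Box \<phi>)
  then obtain L where L: "derives_normal \<phi> L" "\<forall>M :: ('p, 'w) kripke. sat_normal M \<phi> L" by auto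
  with Box.prems show ?case
    using derives_normal_Box[OF L(1)] sat_normal_Box[OF derives_normalD(1)[OF L(1)]] by auto
next
  case (Bul c \<phi>)
  then obtain L where L: "derives_normal \<phi> L" "\<forall>M :: ('p, 'w) kripke. sat_normal M \<phi> L" by auto
  with Bul.prems show ?case
    using derives_normal_Bul[OF L(1)] sat_normal_Bul[OF derives_normalD(1)[OF L(1)]] by auto
next
  case (Atom p)
  then show ?case
    using derives_normal_classical[of "Atom p"] sat_normal_classical[of "Atom p"] by auto
next
  case Bot
  then show ?case using derives_normal_classical[of Bot] sat_normal_classical[of Bot] by auto
next
  case (Neg \<alpha>)
  then show ?case
    using derives_normal_classical[of "Neg \<alpha>"] sat_normal_classical[of "Neg \<alpha>"] by auto
qed

end

section \<open>Canonical model and completeness\<close>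

instance might_op :: countable by countable_datatype
instance fm :: (countable) countable by countable_datatype

lemma countable_formulas:
  assumes "countable (UNIV :: 'p set)" shows "countable (UNIV :: 'p fm set)"
proof -
  obtain f :: "'p \<Rightarrow> nat" where "inj f" using assms by (auto simp: countable_def)
  then have "inj (map_fm f)" by (rule fm.inj_map)
  then have "inj (to_nat \<circ> map_fm f :: 'p fm \<Rightarrow> nat)" by (simp add: inj_compose)
  then show ?thesis by (rule countableI)
qed

context might_logic
begin

text \<open>Used for sets of classical formulas with \<open>\<chi> = \<bottom>\<close>, and for sets of arbitrary formulas of the
  language with the underivable formula as \<open>\<chi>\<close>.\<close>

lemma lindenbaum:
  assumes "\<Gamma> \<subseteq> S" "\<not> \<Gamma> \<turnstile> \<chi>"
  obtains \<Delta> where "\<Gamma> \<subseteq> \<Delta>" "\<Delta> \<subseteq> S" "\<not> \<Delta> \<turnstile> \<chi>" "\<And>\<phi>. \<phi> \<in> S \<Longrightarrow> \<phi> \<notin> \<Delta> \<Longrightarrow> insert \<phi> \<Delta> \<turnstile> \<chi>"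
proof -
  let ?A = "{\<Delta>. \<Gamma> \<subseteq> \<Delta> \<and> \<Delta> \<subseteq> S \<and> \<not> \<Delta> \<turnstile> \<chi>}"
  have "\<exists>M\<in>?A. \<forall>X\<in>?A. M \<subseteq> X \<longrightarrow> X = M"
  proof (rule subset_Zorn_nonempty)
    show "?A \<noteq> {}" using assms by blast
    fix C assume C: "C \<noteq> {}" "subset.chain ?A C"
    then have sub: "C \<subseteq> ?A" by (simp add: subset.chain_def)
    have "\<not> \<Union>C \<turnstile> \<chi>"
    proof
      assume "\<Union>C \<turnstile> \<chi>"
      from finite_support[OF this] obtain \<Gamma>0 where \<Gamma>0: "\<Gamma>0 \<subseteq> \<Union>C" "finite \<Gamma>0" "\<Gamma>0 \<turnstile> \<chi>"
        unfolding fin_derivable_def by blast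
      obtain \<Delta> where "\<Delta> \<in> C" "\<Gamma>0 \<subseteq> \<Delta>"
        using finite_subset_Union_chain[OF \<Gamma>0(2,1) C] by blast
      with weakening[OF \<Gamma>0(3)] sub show False by blast
    qed
    with C(1) sub show "\<Union>C \<in> ?A" by blast
  qed
  then obtain \<Delta> where \<Delta>: "\<Gamma> \<subseteq> \<Delta>" "\<Delta> \<subseteq> S" "\<not> \<Delta> \<turnstile> \<chi>"
    and max: "\<forall>X\<in>?A. \<Delta> \<subseteq> X \<longrightarrow> X = \<Delta>" by blast
  have "insert \<phi> \<Delta> \<turnstile> \<chi>" if "\<phi> \<in> S" "\<phi> \<notin> \<Delta>" for \<phi>
    using max \<Delta> that by blast
  with \<Delta> that show thesis by blast
qed

definition maximal_consistent :: "'p fm set \<Rightarrow> bool"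
  where "maximal_consistent w \<longleftrightarrow> (\<forall>\<alpha>\<in>w. classical \<alpha>) \<and> \<not> w \<turnstile> Bot \<and>
    (\<forall>\<alpha>. classical \<alpha> \<longrightarrow> \<alpha> \<notin> w \<longrightarrow> insert \<alpha> w \<turnstile> Bot)"

lemma maximal_consistent_exists:
  assumes "\<forall>\<alpha>\<in>X. classical \<alpha>" "\<not> X \<turnstile> Bot"
  obtains w where "X \<subseteq> w" "maximal_consistent w"
proof -
  have "X \<subseteq> {\<alpha>. classical \<alpha>}" using assms(1) by blast
  then obtain w where "X \<subseteq> w" "w \<subseteq> {\<alpha>. classical \<alpha>}" "\<not> w \<turnstile> Bot"
      "\<And>\<alpha>. \<alpha> \<in> {\<alpha>. classical \<alpha>} \<Longrightarrow> \<alpha> \<notin> w \<Longrightarrow> insert \<alpha> w \<turnstile> Bot"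
    using lindenbaum[OF _ assms(2)] by metis
  then show thesis using that unfolding maximal_consistent_def by blast
qed

context
  fixes w :: "'p fm set"
  assumes mc: "maximal_consistent w"
begin

lemma mc_classical: "\<alpha> \<in> w \<Longrightarrow> classical \<alpha>"
  using mc unfolding maximal_consistent_def by blast

lemma mc_refutes: "classical \<alpha> \<Longrightarrow> \<alpha> \<notin> w \<Longrightarrow> w \<turnstile> Neg \<alpha>"
  using mc unfolding maximal_consistent_def by (blast intro: NegI'[of w])

lemma mc_closed:
  assumes "w \<turnstile> \<alpha>" "classical \<alpha>" shows "\<alpha> \<in> w"
proof (rule ccontr)
  assume "\<alpha> \<notin> w"
  from derives.NegE[OF assms(2,1) mc_refutes[OF assms(2) this], of Bot] mc
  show False unfolding maximal_consistent_def by simp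
qed

lemma mc_Neg: "classical \<alpha> \<Longrightarrow> Neg \<alpha> \<in> w \<longleftrightarrow> \<alpha> \<notin> w"
proof
  assume \<alpha>: "classical \<alpha>" and n: "Neg \<alpha> \<in> w"
  show "\<alpha> \<notin> w"
  proof
    assume "\<alpha> \<in> w"
    from contradiction[OF this n \<alpha>, of Bot] mc show False unfolding maximal_consistent_def by simp
  qed
next
  assume "classical \<alpha>" "\<alpha> \<notin> w"
  then show "Neg \<alpha> \<in> w" by (intro mc_closed mc_refutes) simp_all
qed

lemma mc_And:
  assumes "classical \<alpha>" "classical \<beta>" shows "And \<alpha> \<beta> \<in> w \<longleftrightarrow> \<alpha> \<in> w \<and> \<beta> \<in> w"
proof
  assume "And \<alpha> \<beta> \<in> w"
  then have "w \<turnstile> And \<alpha> \<beta>" by (rule derives.Ax)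
  then show "\<alpha> \<in> w \<and> \<beta> \<in> w"
    using mc_closed[OF derives.AndE1] mc_closed[OF derives.AndE2] assms by blast
next
  assume "\<alpha> \<in> w \<and> \<beta> \<in> w"
  then have "w \<turnstile> And \<alpha> \<beta>" by (intro derives.AndI derives.Ax) simp_all
  then show "And \<alpha> \<beta> \<in> w" using mc_closed assms by simp
qed

lemma mc_Or:
  assumes "classical \<alpha>" "classical \<beta>" shows "Or \<alpha> \<beta> \<in> w \<longleftrightarrow> \<alpha> \<in> w \<or> \<beta> \<in> w"
proof
  assume *: "Or \<alpha> \<beta> \<in> w"
  show "\<alpha> \<in> w \<or> \<beta> \<in> w"
  proof (rule ccontr)
    assume "\<not> (\<alpha> \<in> w \<or> \<beta> \<in> w)"
    then have "insert \<alpha> w \<turnstile> Bot" "insert \<beta> w \<turnstile> Bot"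
      using mc assms unfolding maximal_consistent_def by blast+
    then have "w \<turnstile> Bot"
      by (rule OrE'[OF order.refl _ derives.Ax[OF *], rotated]) (use mc_classical in blast)
    with mc show False unfolding maximal_consistent_def by blast
  qed
next
  assume "\<alpha> \<in> w \<or> \<beta> \<in> w"
  then have "w \<turnstile> Or \<alpha> \<beta>"
  proof
    assume "\<alpha> \<in> w"
    then show ?thesis by (rule derives.OrI1[OF derives.Ax]) (use assms in \<open>simp add: classical_in_ML\<close>)
  next
    assume "\<beta> \<in> w"
    then show ?thesis by (rule derives.OrI2[OF derives.Ax]) (use assms in \<open>simp add: classical_in_ML\<close>)
  qed
  then show "Or \<alpha> \<beta> \<in> w" using mc_closed assms by simp
qed

lemma mc_Box_counterexample:
  assumes "classical \<alpha>" "Box \<alpha> \<notin> w" shows "Dia (Neg \<alpha>) \<in> w"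
proof (rule mc_closed)
  have "w \<turnstile> Neg (Box \<alpha>)" using mc_refutes assms by simp
  then show "w \<turnstile> Dia (Neg \<alpha>)" by (rule derives.DiaBoxInter[OF assms(1)])
qed (use assms in simp)

text \<open>The interaction rules relate \<open>\<diamond>\<close> and \<open>\<box>\<close> only through negated arguments; a double negation below
  \<open>\<diamond>\<close> makes them applicable to \<open>\<diamond>\<alpha>\<close>.\<close>

lemma mc_Box_Neg_Dia:
  assumes "classical \<alpha>" "Box (Neg \<alpha>) \<in> w" shows "Dia \<alpha> \<notin> w"
proof
  assume "Dia \<alpha> \<in> w"
  then have "w \<turnstile> Dia (Neg (Neg \<alpha>))"
    using derives.DiaMon[OF double_negI[OF assms(1)] derives.Ax] by blast
  then have "w \<turnstile> Neg (Box (Neg \<alpha>))" by (rule derives.BoxDiaInter[rotated]) (use assms in simp)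
  then have "Neg (Box (Neg \<alpha>)) \<in> w" by (rule mc_closed) (use assms in simp)
  with mc_Neg[of "Box (Neg \<alpha>)"] assms show False by simp
qed

lemma mc_Dia_successor:
  assumes "Dia \<alpha> \<in> w"
  obtains v where "maximal_consistent v" "{\<beta>. Box \<beta> \<in> w} \<subseteq> v" "\<alpha> \<in> v"
proof -
  have \<alpha>: "classical \<alpha>" using mc_classical[OF assms] by simp
  let ?X = "insert \<alpha> {\<beta>. Box \<beta> \<in> w}"
  have cl: "\<forall>\<beta>\<in>?X. classical \<beta>" using \<alpha> mc_classical by fastforce
  have "\<not> ?X \<turnstile> Bot"
  proof
    assume "?X \<turnstile> Bot"
    then have "{\<beta>. Box \<beta> \<in> w} \<union> {\<alpha>} \<turnstile> Bot" by simp
    then obtain \<beta>s where \<beta>s: "set \<beta>s \<subseteq> {\<beta>. Box \<beta> \<in> w}" "insert \<alpha> (set \<beta>s) \<turnstile> Bot"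
      by (rule finite_side_formulas)
    have "set \<beta>s \<turnstile> Neg \<alpha>"
      by (rule NegI'[OF order.refl _ \<alpha> \<beta>s(2)]) (use \<beta>s(1) cl in blast)
    then have "w \<turnstile> Box (Neg \<alpha>)"
      by (rule derives.BoxMon) (use \<beta>s(1) derives.Ax in blast)
    then have "Box (Neg \<alpha>) \<in> w" by (rule mc_closed) (use \<alpha> in simp)
    with mc_Box_Neg_Dia[OF \<alpha>] assms show False by blast
  qed
  then obtain v where "?X \<subseteq> v" "maximal_consistent v"
    by (rule maximal_consistent_exists[OF cl])
  then show thesis using that by blast
qed

end

text \<open>A chosen canonical successor that witnesses \<open>\<diamond>\<alpha>\<close>. If there is nothing to witness, the value \<open>w\<close>
  keeps iteration within the maximal consistent sets.\<close>

definition successor :: "'p fm set \<Rightarrow> 'p fm \<Rightarrow> 'p fm set"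
  where "successor w \<alpha> =
    (if Dia \<alpha> \<in> w then SOME v. maximal_consistent v \<and> {\<beta>. Box \<beta> \<in> w} \<subseteq> v \<and> \<alpha> \<in> v else w)"

lemma successor:
  assumes "maximal_consistent w" "Dia \<alpha> \<in> w"
  shows "maximal_consistent (successor w \<alpha>)" "{\<beta>. Box \<beta> \<in> w} \<subseteq> successor w \<alpha>" "\<alpha> \<in> successor w \<alpha>"
proof -
  have "\<exists>v. maximal_consistent v \<and> {\<beta>. Box \<beta> \<in> w} \<subseteq> v \<and> \<alpha> \<in> v"
    using mc_Dia_successor[OF assms] by metis
  from someI_ex[OF this] assms(2)
  show "maximal_consistent (successor w \<alpha>)" "{\<beta>. Box \<beta> \<in> w} \<subseteq> successor w \<alpha>" "\<alpha> \<in> successor w \<alpha>"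
    unfolding successor_def by simp_all
qed

lemma maximal_consistent_foldl:
  "maximal_consistent w \<Longrightarrow> maximal_consistent (foldl successor w \<alpha>s)"
proof (induction \<alpha>s arbitrary: w)
  case (Cons \<alpha> \<alpha>s)
  have "maximal_consistent (successor w \<alpha>)"
    using successor(1)[of w \<alpha>] Cons.prems by (cases "Dia \<alpha> \<in> w") (simp_all add: successor_def)
  then show ?case using Cons.IH by simp
qed simp

text \<open>The canonical model restricted to some of the maximal consistent sets and transported to another
  type of worlds: the elements of \<open>W\<close> are mere names, labelled with maximal consistent sets by \<open>L\<close>.\<close>

definition canonical :: "'w set \<Rightarrow> ('w \<Rightarrow> 'p fm set) \<Rightarrow> ('p, 'w) kripke"
  where "canonical W L = \<lparr>worlds = W,
    rel = {(x, y). x \<in> W \<and> y \<in> W \<and> {\<beta>. Box \<beta> \<in> L x} \<subseteq> L y},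
    val = (\<lambda>p. {x\<in>W. Atom p \<in> L x})\<rparr>"

text \<open>Instead of all maximal consistent sets it suffices to have a witness for each \<open>\<diamond>\<alpha>\<close> in a label.\<close>

lemma canonical_truth:
  assumes mc: "\<forall>x\<in>W. maximal_consistent (L x)"
    and witness: "\<forall>x\<in>W. \<forall>\<alpha>. Dia \<alpha> \<in> L x \<longrightarrow> (\<exists>y\<in>W. {\<beta>. Box \<beta> \<in> L x} \<subseteq> L y \<and> \<alpha> \<in> L y)"
  shows "classical \<alpha> \<Longrightarrow> x \<in> W \<Longrightarrow> sat (canonical W L) {x} \<alpha> \<longleftrightarrow> \<alpha> \<in> L x"
proof (induction \<alpha> arbitrary: x)
  case (Atom p)
  then show ?case by (simp add: canonical_def)
next
  case Bot
  have "Bot \<notin> L x"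
    using mc Bot derives.Ax[of Bot "L x"] unfolding maximal_consistent_def by blast
  then show ?case by simp
next
  case (Neg \<alpha>)
  then show ?case using mc_Neg[of "L x" \<alpha>] mc by simp
next
  case (Or \<alpha> \<beta>)
  then show ?case unfolding sat_world_Or using mc_Or[of "L x" \<alpha> \<beta>] mc by simp
next
  case (And \<alpha> \<beta>)
  then show ?case using mc_And[of "L x" \<alpha> \<beta>] mc by simp
next
  case (Dia \<alpha>)
  have cl: "classical \<alpha>" using Dia.prems by simp
  have rel: "(x, y) \<in> rel (canonical W L) \<longleftrightarrow> x \<in> W \<and> y \<in> W \<and> {\<beta>. Box \<beta> \<in> L x} \<subseteq> L y" for y
    by (simp add: canonical_def)
  have mx: "maximal_consistent (L x)" using mc Dia.prems by blast
  show ?case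
    unfolding sat_world_Dia[OF cl] rel
  proof
    assume "\<exists>y. (x \<in> W \<and> y \<in> W \<and> {\<beta>. Box \<beta> \<in> L x} \<subseteq> L y) \<and> sat (canonical W L) {y} \<alpha>"
    then obtain y where y: "y \<in> W" "{\<beta>. Box \<beta> \<in> L x} \<subseteq> L y" "sat (canonical W L) {y} \<alpha>" by blast
    then have "\<alpha> \<in> L y" using Dia.IH[OF cl] by blast
    moreover have "maximal_consistent (L y)" using mc y(1) by blast
    ultimately have "Neg \<alpha> \<notin> L y" using mc_Neg cl by blast
    with y(2) have "Box (Neg \<alpha>) \<notin> L x" by blast
    with mc_Box_counterexample[OF mx] cl have "Dia (Neg (Neg \<alpha>)) \<in> L x" by simp
    from derives.DiaMon[OF double_negE[OF cl] derives.Ax[OF this]]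
    show "Dia \<alpha> \<in> L x" by (rule mc_closed[OF mx]) (use cl in simp)
  next
    assume "Dia \<alpha> \<in> L x"
    with witness Dia.prems(2) obtain y where "y \<in> W" "{\<beta>. Box \<beta> \<in> L x} \<subseteq> L y" "\<alpha> \<in> L y" by blast
    then show "\<exists>y. (x \<in> W \<and> y \<in> W \<and> {\<beta>. Box \<beta> \<in> L x} \<subseteq> L y) \<and> sat (canonical W L) {y} \<alpha>"
      using Dia.IH[OF cl] Dia.prems(2) by blast
  qed
next
  case (Box \<alpha>)
  have cl: "classical \<alpha>" using Box.prems by simp
  have rel: "(x, y) \<in> rel (canonical W L) \<longleftrightarrow> x \<in> W \<and> y \<in> W \<and> {\<beta>. Box \<beta> \<in> L x} \<subseteq> L y" for y
    by (simp add: canonical_def)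
  have mx: "maximal_consistent (L x)" using mc Box.prems by blast
  show ?case
    unfolding sat_world_Box[OF cl] rel
  proof
    assume all: "\<forall>y. x \<in> W \<and> y \<in> W \<and> {\<beta>. Box \<beta> \<in> L x} \<subseteq> L y \<longrightarrow> sat (canonical W L) {y} \<alpha>"
    show "Box \<alpha> \<in> L x"
    proof (rule ccontr)
      assume "Box \<alpha> \<notin> L x"
      with mc_Box_counterexample[OF mx cl] witness Box.prems(2)
      obtain y where y: "y \<in> W" "{\<beta>. Box \<beta> \<in> L x} \<subseteq> L y" "Neg \<alpha> \<in> L y" by blast
      moreover have "maximal_consistent (L y)" using mc y(1) by blast
      ultimately have "\<alpha> \<notin> L y" using mc_Neg cl by blast
      with all y Box.prems(2) Box.IH[OF cl] show False by blast
    qed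
  next
    assume "Box \<alpha> \<in> L x"
    then show "\<forall>y. x \<in> W \<and> y \<in> W \<and> {\<beta>. Box \<beta> \<in> L x} \<subseteq> L y \<longrightarrow> sat (canonical W L) {y} \<alpha>"
      using Box.IH[OF cl] by blast
  qed
qed simp

text \<open>Closing a countable set of labels under chosen successors leaves it countable, so it can be
  named by elements of an infinite type. \<open>X\<close> is the team whose labels are the given sets.\<close>

lemma countable_canonical:
  fixes T :: "'p fm set set"
  assumes "countable (UNIV :: 'p set)" "infinite (UNIV :: 'w set)"
    and "countable T" and mc: "\<forall>t\<in>T. maximal_consistent t"
  obtains W :: "'w set" and L X where "X \<subseteq> W" "L ` X = T"
    "\<And>\<alpha> x. classical \<alpha> \<Longrightarrow> x \<in> W \<Longrightarrow> sat (canonical W L) {x} \<alpha> \<longleftrightarrow> \<alpha> \<in> L x"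
proof -
  define C where "C = (\<lambda>(t, \<alpha>s). foldl successor t \<alpha>s) ` (T \<times> UNIV)"
  have "countable (UNIV :: 'p fm list set)"
    using countable_lists[of "UNIV :: 'p fm set"] countable_formulas[OF assms(1)] by simp
  with assms(3) have C: "countable C" by (simp add: C_def)
  obtain g :: "nat \<Rightarrow> 'w" where g: "inj g"
    using assms(2) infinite_countable_subset by blast
  define h where "h = g \<circ> to_nat_on C"
  have h: "inj_on h C"
    unfolding h_def using inj_on_to_nat_on[OF C] g by (intro comp_inj_on) (auto intro: inj_on_subset)
  define L where "L = the_inv_into C h"
  have L: "L (h t) = t" if "t \<in> C" for t
    unfolding L_def by (rule the_inv_into_f_f[OF h that])
  have TC: "T \<subseteq> C" unfolding C_def by (force intro: image_eqI[of _ _ "(_, [])"])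
  have mcC: "maximal_consistent t" if "t \<in> C" for t
    using that mc maximal_consistent_foldl by (auto simp: C_def)
  have closed: "successor t \<alpha> \<in> C" if "t \<in> C" for t \<alpha>
  proof -
    from that obtain s \<alpha>s where "s \<in> T" "t = foldl successor s \<alpha>s" by (auto simp: C_def)
    then have "successor t \<alpha> = (\<lambda>(t, \<alpha>s). foldl successor t \<alpha>s) (s, \<alpha>s @ [\<alpha>])" by simp
    with \<open>s \<in> T\<close> show ?thesis unfolding C_def by blast
  qed
  show thesis
  proof (rule that[of "h ` T" "h ` C" L])
    show "h ` T \<subseteq> h ` C" using TC by blast
    have "L (h t) = t" if "t \<in> T" for t using L TC that by blast
    then show "L ` h ` T = T" by (simp add: image_image)
    fix \<alpha> :: "'p fm" and x assume \<alpha>: "classical \<alpha>" "x \<in> h ` C"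
    show "sat (canonical (h ` C) L) {x} \<alpha> \<longleftrightarrow> \<alpha> \<in> L x"
    proof (rule canonical_truth[OF _ _ \<alpha>])
      show "\<forall>x\<in>h ` C. maximal_consistent (L x)" using L mcC by simp
      show "\<forall>x\<in>h ` C. \<forall>\<alpha>. Dia \<alpha> \<in> L x \<longrightarrow> (\<exists>y\<in>h ` C. {\<beta>. Box \<beta> \<in> L x} \<subseteq> L y \<and> \<alpha> \<in> L y)"
      proof (intro ballI allI impI)
        fix x \<alpha> assume "x \<in> h ` C" and *: "Dia \<alpha> \<in> L x"
        then obtain t where t: "t \<in> C" "x = h t" by blast
        with * L have D: "Dia \<alpha> \<in> t" by simp
        note suc = successor[OF mcC[OF t(1)] D]
        show "\<exists>y\<in>h ` C. {\<beta>. Box \<beta> \<in> L x} \<subseteq> L y \<and> \<alpha> \<in> L y"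
          by (rule bexI[of _ "h (successor t \<alpha>)"])
            (use suc L closed[OF t(1)] t in auto)
      qed
    qed
  qed
qed

theorem strong_completeness:
  fixes \<Gamma> :: "'p fm set"
  assumes cnt: "countable (UNIV :: 'p set)" and inf: "infinite (UNIV :: 'w set)"
    and lang: "\<Gamma> \<subseteq> language" "in_ML b \<psi>" and ent: "entails TYPE('w) \<Gamma> \<psi>"
  shows "\<Gamma> \<turnstile> \<psi>"
proof (rule ccontr)
  assume "\<not> \<Gamma> \<turnstile> \<psi>"
  then obtain \<Delta> where \<Delta>: "\<Gamma> \<subseteq> \<Delta>" "\<Delta> \<subseteq> language" "\<not> \<Delta> \<turnstile> \<psi>"
    and max: "\<And>\<phi>. \<phi> \<in> language \<Longrightarrow> \<phi> \<notin> \<Delta> \<Longrightarrow> insert \<phi> \<Delta> \<turnstile> \<psi>"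
    using lindenbaum[OF lang(1)] by metis
  have closed: "\<phi> \<in> \<Delta>" if "\<Delta> \<turnstile> \<phi>" for \<phi>
    using max[of \<phi>] cut_insert[OF _ that \<Delta>(2)] language_closed[OF that \<Delta>(2)] \<Delta>(3) by blast
  have Or_case: "\<nabla> \<beta> \<in> \<Delta> \<or> \<chi> \<in> \<Delta>" if "\<Delta> \<turnstile> Or (\<nabla> \<beta>) \<chi>" for \<beta> \<chi>
  proof (rule ccontr)
    assume n: "\<not> (\<nabla> \<beta> \<in> \<Delta> \<or> \<chi> \<in> \<Delta>)"
    have "in_ML b (Or (\<nabla> \<beta>) \<chi>)" using language_closed[OF that \<Delta>(2)] .
    with n max[of "\<nabla> \<beta>"] max[of \<chi>] have "insert (\<nabla> \<beta>) \<Delta> \<turnstile> \<psi>" "insert \<chi> \<Delta> \<turnstile> \<psi>" by simp_all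
    with OrBulE'[OF that] \<Delta>(3) show False by blast
  qed
  let ?A = "{\<alpha>\<in>\<Delta>. classical \<alpha>}"
  \<comment> \<open>A classical formula outside the maximal set is refuted at some world of the team to be built.\<close>
  have decide: "\<nabla> (Neg \<alpha>) \<in> \<Delta> \<or> \<alpha> \<in> \<Delta>" if "classical \<alpha>" for \<alpha>
    by (rule Or_case[OF might_neg_or[OF that]])
  have decide': "\<nabla> \<alpha> \<in> \<Delta> \<or> Neg \<alpha> \<in> \<Delta>" if "classical \<alpha>" for \<alpha>
  proof (rule ccontr)
    assume n: "\<not> (\<nabla> \<alpha> \<in> \<Delta> \<or> Neg \<alpha> \<in> \<Delta>)"
    with decide[of "Neg \<alpha>"] that have "\<nabla> (Neg (Neg \<alpha>)) \<in> \<Delta>" by simp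
    from might_mono[OF derives.Ax[OF this] double_negE[OF that]] n closed show False by blast
  qed
  \<comment> \<open>A world that realises a might formula and obeys the classical part of the maximal set.\<close>
  have "\<exists>t. maximal_consistent t \<and> insert \<beta> ?A \<subseteq> t" if \<beta>: "\<nabla> \<beta> \<in> \<Delta>" "classical \<beta>" for \<beta>
  proof -
    have 1: "\<not> insert \<beta> ?A \<turnstile> Bot"
    proof
      assume "insert \<beta> ?A \<turnstile> Bot"
      then have "\<Delta> \<turnstile> Neg \<beta>" by (intro NegI'[of ?A]) (use \<beta> in auto)
      from derives.BulNegE[OF \<beta>(2) this derives.Ax[OF \<beta>(1)] lang(2)] \<Delta>(3) show False by blast
    qed
    have 2: "\<forall>\<alpha>\<in>insert \<beta> ?A. classical \<alpha>" using \<beta> by blast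
    from maximal_consistent_exists[OF 2 1] show ?thesis by blast
  qed
  then obtain t where t: "maximal_consistent (t \<beta>)" "insert \<beta> ?A \<subseteq> t \<beta>"
    if "\<nabla> \<beta> \<in> \<Delta>" "classical \<beta>" for \<beta> by metis
  let ?T = "t ` {\<beta>. \<nabla> \<beta> \<in> \<Delta> \<and> classical \<beta>}"
  have T: "maximal_consistent u \<and> ?A \<subseteq> u" if "u \<in> ?T" for u
    using that t by blast
  have Tflat: "(\<forall>u\<in>?T. \<alpha> \<in> u) \<longleftrightarrow> \<alpha> \<in> \<Delta>" if \<alpha>: "classical \<alpha>" for \<alpha>
  proof
    assume all: "\<forall>u\<in>?T. \<alpha> \<in> u"
    show "\<alpha> \<in> \<Delta>"
    proof (rule ccontr)
      assume "\<alpha> \<notin> \<Delta>"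
      with decide[OF \<alpha>] have n: "\<nabla> (Neg \<alpha>) \<in> \<Delta>" by blast
      with t[OF n] \<alpha> have "Neg \<alpha> \<in> t (Neg \<alpha>)" "maximal_consistent (t (Neg \<alpha>))" by simp_all
      moreover have "\<alpha> \<in> t (Neg \<alpha>)" using all n \<alpha> by simp
      ultimately show False using mc_Neg \<alpha> by blast
    qed
  qed (use T \<alpha> in blast)
  have Tmight: "(\<exists>u\<in>?T. \<beta> \<in> u) \<longleftrightarrow> \<nabla> \<beta> \<in> \<Delta>" if \<beta>: "classical \<beta>" for \<beta>
  proof
    assume "\<exists>u\<in>?T. \<beta> \<in> u"
    then obtain u where u: "u \<in> ?T" "\<beta> \<in> u" by blast
    show "\<nabla> \<beta> \<in> \<Delta>"
    proof (rule ccontr)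
      assume "\<nabla> \<beta> \<notin> \<Delta>"
      with decide'[OF \<beta>] have "Neg \<beta> \<in> ?A" using \<beta> by simp
      with T[OF u(1)] u(2) mc_Neg \<beta> show False by blast
    qed
  next
    assume "\<nabla> \<beta> \<in> \<Delta>"
    with t[OF this \<beta>] \<beta> show "\<exists>u\<in>?T. \<beta> \<in> u" by blast
  qed
  have T_countable: "countable ?T"
    using countable_formulas[OF cnt] by (intro countable_image) (rule countable_subset[OF subset_UNIV])
  have T_mc: "\<forall>u\<in>?T. maximal_consistent u" using T by blast
  obtain W :: "'w set" and L X where X: "X \<subseteq> W" "L ` X = ?T"
    and truth: "\<And>\<alpha> x. classical \<alpha> \<Longrightarrow> x \<in> W \<Longrightarrow> sat (canonical W L) {x} \<alpha> \<longleftrightarrow> \<alpha> \<in> L x"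
    by (rule countable_canonical[OF cnt inf T_countable T_mc]) blast
  let ?M = "canonical W L"
  have clause: "sat_clause ?M X c \<longleftrightarrow> clause_set c \<subseteq> \<Delta>" if c: "classical_clause c" for c
  proof -
    have cl: "classical (fst c)" "\<forall>\<beta>\<in>set (snd c). classical \<beta>"
      using c unfolding classical_clause_def by simp_all
    \<comment> \<open>The team must not be empty, as the empty team satisfies every clause.\<close>
    have "\<nabla> (Neg Bot) \<in> \<Delta>" by (rule closed[OF derives.BulI[OF _ top]]) simp
    then have "?T \<noteq> {}" by auto
    then have "X \<noteq> {}" using X(2) by blast
    moreover have "(\<forall>x\<in>X. sat ?M {x} (fst c)) \<longleftrightarrow> fst c \<in> \<Delta>"
      unfolding Tflat[OF cl(1), symmetric] X(2)[symmetric] using truth[OF cl(1)] X(1) by blast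
    moreover have "(\<exists>x\<in>X. sat ?M {x} \<beta>) \<longleftrightarrow> \<nabla> \<beta> \<in> \<Delta>" if "\<beta> \<in> set (snd c)" for \<beta>
    proof -
      have "classical \<beta>" using cl(2) that by blast
      then show ?thesis
        unfolding Tmight[OF \<open>classical \<beta>\<close>, symmetric] X(2)[symmetric] using truth X(1) by blast
    qed
    ultimately show ?thesis by (auto simp: sat_clause_def clause_set_def)
  qed
  have truth_lemma: "sat ?M X \<phi> \<longleftrightarrow> \<phi> \<in> \<Delta>" if in_ML: "in_ML b \<phi>" for \<phi>
  proof -
    obtain N where N: "derives_normal \<phi> N" "sat_normal ?M \<phi> N"
      using normal_form[OF in_ML] by blast
    note cl = derives_normalD(1)[OF N(1)]
    have "sat ?M X \<phi> \<longleftrightarrow> (\<exists>c\<in>set N. clause_set c \<subseteq> \<Delta>)"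
      using N(2) clause cl unfolding sat_normal_def by blast
    also have "\<dots> \<longleftrightarrow> \<phi> \<in> \<Delta>"
    proof
      assume "\<exists>c\<in>set N. clause_set c \<subseteq> \<Delta>"
      then show "\<phi> \<in> \<Delta>" using derives_normalD(2)[OF N(1)] weakening closed by blast
    next
      assume \<phi>: "\<phi> \<in> \<Delta>"
      show "\<exists>c\<in>set N. clause_set c \<subseteq> \<Delta>"
      proof (rule ccontr)
        assume n: "\<not> (\<exists>c\<in>set N. clause_set c \<subseteq> \<Delta>)"
        have "\<forall>c\<in>set N. \<Delta> \<union> clause_set c \<turnstile> \<psi>"
        proof
          fix c assume c: "c \<in> set N"
          with n obtain \<gamma> where \<gamma>: "\<gamma> \<in> clause_set c" "\<gamma> \<notin> \<Delta>" by blast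
          then have "insert \<gamma> \<Delta> \<turnstile> \<psi>" using clause_in_language(1) cl c max by blast
          then show "\<Delta> \<union> clause_set c \<turnstile> \<psi>" by (rule weakening) (use \<gamma> in blast)
        qed
        with derives_normalD(3)[OF N(1) \<Delta>(2) lang(2) derives.Ax[OF \<phi>]] \<Delta>(3) show False by blast
      qed
    qed
    finally show ?thesis .
  qed
  have "kripke_model ?M" by (auto simp: kripke_model_def canonical_def)
  moreover have "X \<subseteq> worlds ?M" using X(1) by (simp add: canonical_def)
  moreover have "\<forall>\<gamma>\<in>\<Gamma>. sat ?M X \<gamma>" using truth_lemma lang(1) \<Delta>(1) by blast
  ultimately have "sat ?M X \<psi>" using ent unfolding entails_def by blast
  then have "\<psi> \<in> \<Delta>" using truth_lemma lang(2) by blast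
  with \<Delta>(3) derives.Ax show False by blast
qed

end

theorem theorem4p21:
  fixes b :: might_op
    and \<Gamma> :: "'p fm set"
    and \<psi> :: "'p fm"
  assumes "countable (UNIV :: 'p set)" and "infinite (UNIV :: 'p set)"
    and "infinite (UNIV :: 'w set)"
    and "\<forall>\<phi>\<in>\<Gamma> \<union> {\<psi>}. in_ML b \<phi>"
    and "entails TYPE('w) \<Gamma> \<psi>"
  shows "derives b \<Gamma> \<psi>"
  by (rule might_logic.strong_completeness[OF assms(1,3) _ _ assms(5)]) (use assms(4) in auto)

end
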